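(* Let $h$ be a hyperbonode of a generic smooth surface. Write the surface near $h$ in Monge form $z=f(x,y)$ with $h$ at the origin, $f(0,0)=0$, $df(0,0)=0$, and with the two asymptotic lines at $h$ as the $x$- and $y$-coordinate axes. Then the cr-invariant of $h$ is $$\rho(h)=1-\frac{(3f_{21}^2-2f_{11}f_{31})(3f_{12}^2-2f_{11}f_{13})}{4f_{11}^2f_{40}f_{04}},$$ where $f_{ij}=\frac{\partial^{i+j}f}{\partial x^i\partial y^j}(0,0)$.
   Context: Setting. Surfaces lie in $\mathbb{R}\mathrm{P}^3$, and the affine chart $\{[x:y:z:1]\}$ is identified with $\mathbb{R}^3$. An asymptotic line at a point of $S$ is a tangent line having more than $2$-point contact with $S$ there. A point is hyperbolic if it has two distinct real asymptotic lines. An asymptotic curve is an integral curve of a field of asymptotic directions. Left and right. Fix an orientation of the ambient space. A regularly parametrised curve is left (right) if its first three derivatives form a negative (positive) frame. At each hyperbolic point one asymptotic curve is left and the other is right (at points where the frame degenerates the label is extended by continuity along the field of asymptotic directions). Their tangent lines are the left and right asymptotic lines $L_\ell,L_r$. The left (right) flecnodal curve $F_\ell$ (resp. $F_r$) is the set of hyperbolic points at which the left (right) asymptotic line has more than $3$-point contact with $S$. Hyperbonodes. A hyperbonode is a point of intersection of $F_\ell$ and $F_r$ (equivalently, a hyperbolic point where $S$ is approximated by a quadric up to order $3$). Cr-invariant. Let $L_{F_\ell},L_{F_r}$ be the tangent lines of $F_\ell,F_r$ at $h$. Then $\rho(h)=(L_{F_\ell},L_r,L_{F_r},L_\ell)$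 is the cross-ratio of these four lines of the tangent plane through $h$, where the cross-ratio of four lines with parameters $x_1,x_2,x_3,x_4$ is $\frac{(x_1-x_3)(x_2-x_4)}{(x_1-x_4)(x_2-x_3)}$. Genericity. At a hyperbonode of a generic surface, $F_\ell$ and $F_r$ are smooth and transverse to each other, and each asymptotic line has exactly $4$-point contact with the surface (so $\rho(h)\ne 0,\infty$). *)

theory Defs
  imports "HOL-Analysis.Analysis"
begin

section \<open>Smooth maps and partial derivatives\<close>

primrec Ck_on :: "nat \<Rightarrow> 'a::real_normed_vector set \<Rightarrow> ('a \<Rightarrow> 'b::real_normed_vector) \<Rightarrow> bool" where
  "Ck_on 0 U f \<longleftrightarrow> continuous_on U f"
| "Ck_on (Suc k) U f \<longleftrightarrow> (\<forall>x\<in>U. f differentiable (at x)) \<and>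
     (\<forall>v. Ck_on k U (\<lambda>x. frechet_derivative f (at x) v))"

text \<open>Intended for open \<open>U\<close> in a finite-dimensional space.\<close>

definition smooth_on :: "'a::real_normed_vector set \<Rightarrow> ('a \<Rightarrow> 'b::real_normed_vector) \<Rightarrow> bool" where
  "smooth_on U f \<longleftrightarrow> (\<forall>k. Ck_on k U f)"

definition partial0 :: "nat \<Rightarrow> nat \<Rightarrow> (real \<Rightarrow> real \<Rightarrow> real) \<Rightarrow> real" where
  "partial0 i j f = (deriv ^^ i) (\<lambda>x. (deriv ^^ j) (\<lambda>y. f x y) 0) 0"

definition nth_vector_derivative :: "nat \<Rightarrow> (real \<Rightarrow> 'a::real_normed_vector) \<Rightarrow> real \<Rightarrow> 'a" where
  "nth_vector_derivative k c = ((\<lambda>c t. vector_derivative c (at t)) ^^ k) c"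


section \<open>Surfaces, lines and contact\<close>

text \<open>All notions below are local and are stated in an affine chart \<open>\<real>\<^sup>3\<close> of projective space.\<close>

definition local_equation ::
    "(real^3) set \<Rightarrow> real^3 \<Rightarrow> (real^3) set \<Rightarrow> (real^3 \<Rightarrow> real) \<Rightarrow> bool" where
  "local_equation S p W g \<longleftrightarrow> open W \<and> p \<in> W \<and> smooth_on W g \<and>
     frechet_derivative g (at p) \<noteq> (\<lambda>_. 0) \<and> S \<inter> W = {q \<in> W. g q = 0}"

definition smooth_surface :: "(real^3) set \<Rightarrow> bool" where
  "smooth_surface S \<longleftrightarrow> (\<forall>p\<in>S. \<exists>W g. local_equation S p W g)"

definition line_through :: "real^3 \<Rightarrow> real^3 \<Rightarrow> (real^3) set" where
  "line_through p v = range (\<lambda>t. p + t *\<^sub>R v)"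

text \<open>The line has \<open>n\<close>-point contact with \<open>S\<close> at \<open>p\<close> if a local equation of \<open>S\<close>, restricted to
  the line, has a zero of multiplicity \<open>n\<close> at \<open>p\<close>; this does not depend on the local equation.
  More than \<open>k\<close>-point contact thus means that the derivatives of orders \<open>0, \<dots>, k\<close> vanish.\<close>

definition contact_more_than :: "nat \<Rightarrow> (real^3) set \<Rightarrow> real^3 \<Rightarrow> (real^3) set \<Rightarrow> bool" where
  "contact_more_than k S p L \<longleftrightarrow> (\<exists>v W g. v \<noteq> 0 \<and> L = line_through p v \<and> local_equation S p W g \<and>
     (\<forall>j\<le>k. (deriv ^^ j) (\<lambda>t. g (p + t *\<^sub>R v)) 0 = 0))"

definition contact_exactly :: "nat \<Rightarrow> (real^3) set \<Rightarrow> real^3 \<Rightarrow> (real^3) set \<Rightarrow> bool" where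
  "contact_exactly n S p L \<longleftrightarrow> contact_more_than (n - 1) S p L \<and> \<not> contact_more_than n S p L"

text \<open>Tangency of the line is implied by the vanishing of the first derivative.\<close>

definition asymptotic_line :: "(real^3) set \<Rightarrow> real^3 \<Rightarrow> (real^3) set \<Rightarrow> bool" where
  "asymptotic_line S p L \<longleftrightarrow> contact_more_than 2 S p L"

definition hyperbolic_point :: "(real^3) set \<Rightarrow> real^3 \<Rightarrow> bool" where
  "hyperbolic_point S p \<longleftrightarrow> p \<in> S \<and> card {L. asymptotic_line S p L} = 2"


section \<open>Asymptotic curves, left and right\<close>

definition asymptotic_field :: "(real^3) set \<Rightarrow> (real^3) set \<Rightarrow> (real^3 \<Rightarrow> real^3) \<Rightarrow> bool" where
  "asymptotic_field S N V \<longleftrightarrow> continuous_on N V \<and>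
     (\<forall>q\<in>N. V q \<noteq> 0 \<and> asymptotic_line S q (line_through q (V q)))"

text \<open>The field is regarded as a field of directions, so that any regular parametrisation of
  an integral curve is allowed.\<close>

definition integral_curve ::
    "(real^3) set \<Rightarrow> (real^3 \<Rightarrow> real^3) \<Rightarrow> real \<Rightarrow> (real \<Rightarrow> real^3) \<Rightarrow> bool" where
  "integral_curve N V e c \<longleftrightarrow> e > 0 \<and> smooth_on {-e<..<e} c \<and>
     (\<forall>t\<in>{-e<..<e}. c t \<in> N \<and> vector_derivative c (at t) \<noteq> 0 \<and>
        vector_derivative c (at t) \<in> span {V (c t)})"

text \<open>An orientation of the ambient space is given by a sign \<open>\<omega> = \<plusminus>1\<close>: a frame is positive iff
  \<open>\<omega>\<close> times its determinant is positive.\<close>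

definition frame_det :: "(real \<Rightarrow> real^3) \<Rightarrow> real \<Rightarrow> real" where
  "frame_det c t = det (vector [nth_vector_derivative 1 c t, nth_vector_derivative 2 c t,
     nth_vector_derivative 3 c t] :: real^3^3)"

text \<open>The label of the asymptotic line at \<open>p\<close> is the sign of the frames of the integral curves of a
  field \<open>V\<close> of asymptotic directions near \<open>p\<close>. Frames are allowed to degenerate, also at \<open>p\<close> itself
  (this happens precisely at flecnodal points), but \<open>p\<close> has to be a limit of points with a
  nondegenerate frame; all of those near \<open>p\<close> must have the same sign. If the frame at \<open>p\<close> is
  nondegenerate, then the label is just its sign.\<close>

definition asymptotic_line_of_sign ::
    "real \<Rightarrow> (real^3) set \<Rightarrow> real^3 \<Rightarrow> (real^3) set \<Rightarrow> bool" where
  "asymptotic_line_of_sign s S p L \<longleftrightarrow> (\<exists>W V. open W \<and> p \<in> W \<and> p \<in> S \<and>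
     asymptotic_field S (S \<inter> W) V \<and> L = line_through p (V p) \<and>
     (\<forall>e c. integral_curve (S \<inter> W) V e c \<longrightarrow> s * frame_det c 0 \<ge> 0) \<and>
     p \<in> closure {c 0 | c e. integral_curve (S \<inter> W) V e c \<and> s * frame_det c 0 > 0})"

definition left_asymptotic_line :: "real \<Rightarrow> (real^3) set \<Rightarrow> real^3 \<Rightarrow> (real^3) set \<Rightarrow> bool" where
  "left_asymptotic_line \<omega> = asymptotic_line_of_sign (- \<omega>)"

definition right_asymptotic_line :: "real \<Rightarrow> (real^3) set \<Rightarrow> real^3 \<Rightarrow> (real^3) set \<Rightarrow> bool" where
  "right_asymptotic_line \<omega> = asymptotic_line_of_sign \<omega>"

definition left_flecnodal_curve :: "real \<Rightarrow> (real^3) set \<Rightarrow> (real^3) set" where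
  "left_flecnodal_curve \<omega> S = {p. hyperbolic_point S p \<and>
     (\<exists>L. left_asymptotic_line \<omega> S p L \<and> contact_more_than 3 S p L)}"

definition right_flecnodal_curve :: "real \<Rightarrow> (real^3) set \<Rightarrow> (real^3) set" where
  "right_flecnodal_curve \<omega> S = {p. hyperbolic_point S p \<and>
     (\<exists>L. right_asymptotic_line \<omega> S p L \<and> contact_more_than 3 S p L)}"


section \<open>Hyperbonodes and the cr-invariant\<close>

definition smooth_curve_at :: "(real^3) set \<Rightarrow> real^3 \<Rightarrow> (real^3) set \<Rightarrow> bool" where
  "smooth_curve_at C p T \<longleftrightarrow> (\<exists>W e c d. open W \<and> p \<in> W \<and> e > 0 \<and> smooth_on {-e<..<e} c \<and>
     (\<forall>t\<in>{-e<..<e}. vector_derivative c (at t) \<noteq> 0) \<and>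
     homeomorphism {-e<..<e} (C \<inter> W) c d \<and> c 0 = p \<and>
     T = line_through p (vector_derivative c (at 0)))"

text \<open>\<open>smooth_curve_at C p T\<close>: near \<open>p\<close>, the set \<open>C\<close> is a smooth curve, with tangent line \<open>T\<close> at \<open>p\<close>.\<close>

definition tangent_line :: "(real^3) set \<Rightarrow> real^3 \<Rightarrow> (real^3) set" where
  "tangent_line C p = (THE T. smooth_curve_at C p T)"

definition hyperbonode :: "real \<Rightarrow> (real^3) set \<Rightarrow> real^3 \<Rightarrow> bool" where
  "hyperbonode \<omega> S h \<longleftrightarrow> h \<in> left_flecnodal_curve \<omega> S \<inter> right_flecnodal_curve \<omega> S"

text \<open>A hyperbonode satisfying the conditions that hold at all hyperbonodes of a generic surface.\<close>

definition generic_hyperbonode :: "real \<Rightarrow> (real^3) set \<Rightarrow> real^3 \<Rightarrow> bool" where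
  "generic_hyperbonode \<omega> S h \<longleftrightarrow> hyperbonode \<omega> S h \<and>
     (\<exists>Tl Tr. smooth_curve_at (left_flecnodal_curve \<omega> S) h Tl \<and>
        smooth_curve_at (right_flecnodal_curve \<omega> S) h Tr \<and> Tl \<noteq> Tr) \<and>
     (\<forall>L. asymptotic_line S h L \<longrightarrow> contact_exactly 4 S h L)"

text \<open>Any affine parameter on the pencil of lines through \<open>p\<close> in a plane may be used, as long as it is
  finite on the four given lines; the value does not depend on the choice of \<open>u\<close> and \<open>w\<close>.\<close>

definition cross_ratio ::
    "real^3 \<Rightarrow> (real^3) set \<Rightarrow> (real^3) set \<Rightarrow> (real^3) set \<Rightarrow> (real^3) set \<Rightarrow> real" where
  "cross_ratio p L1 L2 L3 L4 = (THE r. \<exists>u w x1 x2 x3 x4. u \<noteq> w \<and> independent {u, w} \<and>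
     L1 = line_through p (u + x1 *\<^sub>R w) \<and> L2 = line_through p (u + x2 *\<^sub>R w) \<and>
     L3 = line_through p (u + x3 *\<^sub>R w) \<and> L4 = line_through p (u + x4 *\<^sub>R w) \<and>
     r = ((x1 - x3) * (x2 - x4)) / ((x1 - x4) * (x2 - x3)))"

definition cr_invariant :: "real \<Rightarrow> (real^3) set \<Rightarrow> real^3 \<Rightarrow> real" where
  "cr_invariant \<omega> S h = cross_ratio h
     (tangent_line (left_flecnodal_curve \<omega> S) h) (THE L. right_asymptotic_line \<omega> S h L)
     (tangent_line (right_flecnodal_curve \<omega> S) h) (THE L. left_asymptotic_line \<omega> S h L)"

end

theory Submission
  imports Defs
begin

text \<open>
  The contact of a line with \<open>S\<close> may be computed from the Monge equation \<open>f(x, y) - z\<close>, since every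
  local equation \<open>g\<close> satisfies \<open>\<bar>f(x, y) - z\<bar> \<le> K * \<bar>g\<bar>\<close> nearby. Along an asymptotic curve
  \<open>(x, y, z)\<close> the frame determinant is
  \<open>(x' y'' - y' x'') (x'' (f\<^sub>x\<^sub>x x' + f\<^sub>x\<^sub>y y') + y'' (f\<^sub>x\<^sub>y x' + f\<^sub>y\<^sub>y y'))\<close>; near the origin it has the
  sign of \<open>f\<^sub>1\<^sub>1\<close> if the direction is close to the \<open>x\<close>-axis and the opposite sign if it is close
  to the \<open>y\<close>-axis. So near the origin a label determines one of the two families of asymptotic
  directions, and no integral curve has to be constructed. In the first family, a flecnodal point
  has a slope \<open>m\<close> with \<open>f\<^sub>x\<^sub>x + 2 m f\<^sub>x\<^sub>y + m\<^sup>2 f\<^sub>y\<^sub>y = 0\<close> and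
  \<open>f\<^sub>x\<^sub>x\<^sub>x + 3 m f\<^sub>x\<^sub>x\<^sub>y + 3 m\<^sup>2 f\<^sub>x\<^sub>y\<^sub>y + m\<^sup>3 f\<^sub>y\<^sub>y\<^sub>y = 0\<close>. Differentiating both equations along the flecnodal
  curve yields its tangent line \<open>2 f\<^sub>1\<^sub>1 f\<^sub>4\<^sub>0 x = (3 f\<^sub>2\<^sub>1\<^sup>2 - 2 f\<^sub>1\<^sub>1 f\<^sub>3\<^sub>1) y\<close>, and symmetrically for the
  other family. Exchanging left and right does not change the cross-ratio.
\<close>

section \<open>Smooth functions and directional derivatives\<close>

text \<open>With the direction fixed, the derivative is again a function on the same space. So
  \<open>ddir v ^^ j\<close> is the j-th derivative along \<open>v\<close>, and the recursion of
  \<open>Ck_on\<close> becomes closure of \<open>smooth_on\<close> under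
  \<open>ddir v\<close>.\<close>

definition ddir :: "'a::real_normed_vector \<Rightarrow> ('a \<Rightarrow> 'b::real_normed_vector) \<Rightarrow> 'a \<Rightarrow> 'b" where
  "ddir v f = (\<lambda>x. frechet_derivative f (at x) v)"

lemma ddir_eqI: "(f has_derivative f') (at x) \<Longrightarrow> ddir v f x = f' v"
  by (metis ddir_def frechet_derivative_at)

lemma smooth_on_ddir: "smooth_on U f \<Longrightarrow> smooth_on U (ddir v f)"
  unfolding smooth_on_def ddir_def by (metis Ck_on.simps(2))

lemma smooth_on_ddir_funpow: "smooth_on U f \<Longrightarrow> smooth_on U ((ddir v ^^ j) f)"
  by (induction j) (auto intro: smooth_on_ddir)

lemma smooth_on_differentiable: "smooth_on U f \<Longrightarrow> x \<in> U \<Longrightarrow> f differentiable (at x)"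
  unfolding smooth_on_def by (metis Ck_on.simps(2))

lemma smooth_on_has_derivative:
  "smooth_on U f \<Longrightarrow> x \<in> U \<Longrightarrow> (f has_derivative (\<lambda>v. ddir v f x)) (at x)"
  unfolding ddir_def using smooth_on_differentiable frechet_derivative_works by blast

lemma smooth_on_isCont: "smooth_on U f \<Longrightarrow> x \<in> U \<Longrightarrow> isCont f x"
  using smooth_on_differentiable differentiable_imp_continuous_within by blast

lemma linear_ddir: "smooth_on U f \<Longrightarrow> x \<in> U \<Longrightarrow> linear (\<lambda>v. ddir v f x)"
  using smooth_on_has_derivative has_derivative_linear by blast

lemma ddir_cong:
  assumes "open U" "smooth_on U f" "\<And>x. x \<in> U \<Longrightarrow> f x = g x" "x \<in> U"
  shows "ddir v f x = ddir v g x"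
  unfolding ddir_def
  using frechet_derivative_transform_within_open[OF smooth_on_differentiable[OF assms(2,4)] assms(1,4)]
    assms(3) by metis

section \<open>Closure properties of smooth functions\<close>

lemma Ck_on_cong:
  assumes "open U" "\<And>x. x \<in> U \<Longrightarrow> f x = g x" "Ck_on k U f"
  shows "Ck_on k U g"
  using assms(2,3)
proof (induction k arbitrary: f g)
  case 0
  then show ?case by (metis Ck_on.simps(1) continuous_on_cong)
next
  case (Suc k)
  have d: "f differentiable (at x)" if "x \<in> U" for x using Suc.prems that by simp
  have "g differentiable (at x)" if "x \<in> U" for x
    using d[OF that] Suc.prems(1) assms(1) that
    by (meson differentiable_def has_derivative_transform_within_open)
  moreover have "Ck_on k U (\<lambda>x. frechet_derivative g (at x) v)" for v
  proof (rule Suc.IH)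
    show "frechet_derivative f (at x) v = frechet_derivative g (at x) v" if "x \<in> U" for x
      using frechet_derivative_transform_within_open[OF d[OF that] assms(1) that] Suc.prems(1) by metis
    show "Ck_on k U (\<lambda>x. frechet_derivative f (at x) v)" using Suc.prems by simp
  qed
  ultimately show ?case by simp
qed

lemma smooth_on_cong:
  "open U \<Longrightarrow> (\<And>x. x \<in> U \<Longrightarrow> f x = g x) \<Longrightarrow> smooth_on U f \<Longrightarrow> smooth_on U g"
  unfolding smooth_on_def using Ck_on_cong by blast

lemma Ck_on_subset: "Ck_on k U f \<Longrightarrow> V \<subseteq> U \<Longrightarrow> Ck_on k V f"
  by (induction k arbitrary: f) (auto intro: continuous_on_subset)

lemma smooth_on_subset: "smooth_on U f \<Longrightarrow> V \<subseteq> U \<Longrightarrow> smooth_on V f"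
  unfolding smooth_on_def using Ck_on_subset by blast

lemma Ck_on_const: "Ck_on k U (\<lambda>_. c)"
  by (induction k arbitrary: c) (auto simp: frechet_derivative_const)

lemma Ck_on_bounded_linear:
  assumes "bounded_linear L"
  shows "Ck_on k U L"
proof (cases k)
  case 0
  then show ?thesis using assms by (simp add: linear_continuous_on)
next
  case (Suc n)
  have "frechet_derivative L (at x) = L" for x
    using assms frechet_derivative_at bounded_linear_imp_has_derivative by metis
  then show ?thesis using Suc assms
    by (auto simp: Ck_on_const bounded_linear_imp_differentiable)
qed

lemma Ck_on_diff:
  assumes "open U" "Ck_on k U f" "Ck_on k U g"
  shows "Ck_on k U (\<lambda>x. f x - g x)"
  using assms(2,3)
proof (induction k arbitrary: f g)
  case 0
  then show ?case by (simp add: continuous_on_diff)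
next
  case (Suc k)
  show ?case
    unfolding Ck_on.simps
  proof (intro conjI ballI allI)
    fix x assume "x \<in> U"
    then show "(\<lambda>x. f x - g x) differentiable (at x)" using Suc.prems by auto
  next
    fix v
    have "Ck_on k U (\<lambda>x. frechet_derivative f (at x) v - frechet_derivative g (at x) v)"
      using Suc by simp
    then show "Ck_on k U (\<lambda>x. frechet_derivative (\<lambda>x. f x - g x) (at x) v)"
    proof (rule Ck_on_cong[OF assms(1), rotated])
      fix x assume "x \<in> U"
      then have "((\<lambda>x. f x - g x) has_derivative
          (\<lambda>v. frechet_derivative f (at x) v - frechet_derivative g (at x) v)) (at x)"
        using Suc.prems by (intro has_derivative_diff) (auto simp flip: frechet_derivative_works)
      then show "frechet_derivative f (at x) v - frechet_derivative g (at x) v =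
          frechet_derivative (\<lambda>x. f x - g x) (at x) v"
        by (metis frechet_derivative_at)
    qed
  qed
qed

text \<open>By the chain rule, the derivative of the composite along \<open>v\<close> is the
  derivative of \<open>f\<close> along \<open>L v\<close>, again composed with \<open>L\<close>; so
  the induction stays within composites with \<open>L\<close>.\<close>

lemma Ck_on_compose_linear:
  assumes "open U" "bounded_linear L" "Ck_on k U f"
  shows "Ck_on k (L -` U) (\<lambda>x. f (L x))"
  using assms(3)
proof (induction k arbitrary: f)
  case 0
  then show ?case
    using assms(2) continuous_on_compose2[of U f "L -` U" L] by (auto intro: linear_continuous_on)
next
  case (Suc k)
  have o: "open (L -` U)"
    using assms by (simp add: open_vimage linear_continuous_on)
  have d: "((\<lambda>x. f (L x)) has_derivative (\<lambda>v. frechet_derivative f (at (L x)) (L v))) (at x)"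
    if "x \<in> L -` U" for x
  proof -
    have "(f has_derivative frechet_derivative f (at (L x))) (at (L x))"
      using Suc.prems that by (simp flip: frechet_derivative_works)
    from has_derivative_compose[OF bounded_linear_imp_has_derivative[OF assms(2)] this]
    show ?thesis .
  qed
  show ?case
    unfolding Ck_on.simps
  proof (intro conjI ballI allI)
    fix x assume "x \<in> L -` U"
    then show "(\<lambda>x. f (L x)) differentiable (at x)" using d differentiable_def by blast
  next
    fix v
    have "Ck_on k (L -` U) (\<lambda>x. frechet_derivative f (at (L x)) (L v))"
      using Suc.IH[of "\<lambda>x. frechet_derivative f (at x) (L v)"] Suc.prems by simp
    then show "Ck_on k (L -` U) (\<lambda>x. frechet_derivative (\<lambda>x. f (L x)) (at x) v)"
      by (rule Ck_on_cong[OF o, rotated]) (metis frechet_derivative_at d)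
  qed
qed

section \<open>Derivatives along lines and symmetry of mixed derivatives\<close>

lemma DERIV_along_line:
  fixes f :: "'a::real_normed_vector \<Rightarrow> real"
  assumes "smooth_on U f" "p + t *\<^sub>R v \<in> U"
  shows "((\<lambda>t. f (p + t *\<^sub>R v)) has_real_derivative ddir v f (p + t *\<^sub>R v)) (at t)"
proof -
  have "((\<lambda>t. p + t *\<^sub>R v) has_derivative (\<lambda>t. t *\<^sub>R v)) (at t)"
    by (auto intro!: derivative_eq_intros)
  from has_derivative_compose[OF this smooth_on_has_derivative[OF assms]]
  have "((\<lambda>t. f (p + t *\<^sub>R v)) has_derivative (\<lambda>s. ddir (s *\<^sub>R v) f (p + t *\<^sub>R v))) (at t)" .
  then show ?thesis
    unfolding has_field_derivative_def
    by (simp add: linear_scale[OF linear_ddir[OF assms]] mult.commute[of _ "ddir _ _ _"])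
qed

lemma eventually_on_line:
  fixes p v :: "'a::real_normed_vector"
  assumes "open U" "p + t *\<^sub>R v \<in> U"
  shows "eventually (\<lambda>t. p + t *\<^sub>R v \<in> U) (nhds t)"
proof -
  have "isCont (\<lambda>t. p + t *\<^sub>R v) t" by (intro continuous_intros)
  then have "((\<lambda>t. p + t *\<^sub>R v) \<longlongrightarrow> p + t *\<^sub>R v) (nhds t)"
    by (simp add: isCont_def tendsto_nhds_iff)
  then show ?thesis using assms by (metis topological_tendstoD)
qed

text \<open>Translates the iterated \<open>deriv\<close> in the definitions of contact and of
  \<open>partial0\<close> into \<open>ddir\<close>. The induction varies \<open>t\<close>, because
  the outer \<open>deriv\<close> needs the previous equality on a neighbourhood of
  \<open>t\<close>.\<close>

lemma higher_deriv_along_line: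
  fixes f :: "'a::real_normed_vector \<Rightarrow> real"
  assumes "open U" "smooth_on U f" "p + t *\<^sub>R v \<in> U"
  shows "(deriv ^^ j) (\<lambda>t. f (p + t *\<^sub>R v)) t = (ddir v ^^ j) f (p + t *\<^sub>R v)"
  using assms(3)
proof (induction j arbitrary: t)
  case 0
  then show ?case by simp
next
  case (Suc j)
  have "eventually (\<lambda>t. (deriv ^^ j) (\<lambda>t. f (p + t *\<^sub>R v)) t = (ddir v ^^ j) f (p + t *\<^sub>R v)) (nhds t)"
    using eventually_on_line[OF assms(1) Suc.prems] by eventually_elim (rule Suc.IH)
  then have "deriv ((deriv ^^ j) (\<lambda>t. f (p + t *\<^sub>R v))) t = deriv (\<lambda>t. (ddir v ^^ j) f (p + t *\<^sub>R v)) t"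
    by (rule deriv_cong_ev) simp
  also have "\<dots> = ddir v ((ddir v ^^ j) f) (p + t *\<^sub>R v)"
    using DERIV_along_line[OF smooth_on_ddir_funpow[OF assms(2)] Suc.prems] by (rule DERIV_imp_deriv)
  finally show ?case by simp
qed

text \<open>Two applications of the mean value theorem, first along \<open>v\<close>, then along
  \<open>w\<close>. The second difference is symmetric in \<open>v\<close> and \<open>w\<close>,
  while the iterated derivative obtained from it depends on their order.\<close>

lemma second_difference:
  fixes f :: "'a::real_normed_vector \<Rightarrow> real"
  assumes f: "smooth_on (ball p r) f" and h: "0 < h" "h * (norm v + norm w) < r"
  shows "\<exists>q. dist p q < r \<and> dist p q \<le> h * (norm v + norm w) \<and>
    f (p + h *\<^sub>R v + h *\<^sub>R w) - f (p + h *\<^sub>R v) - f (p + h *\<^sub>R w) + f p = h\<^sup>2 * ddir w (ddir v f) q"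
proof -
  have close: "dist p (p + s *\<^sub>R v + t *\<^sub>R w) \<le> h * (norm v + norm w)"
    if "0 \<le> s" "s \<le> h" "0 \<le> t" "t \<le> h" for s t
  proof -
    have "dist p (p + s *\<^sub>R v + t *\<^sub>R w) = norm (s *\<^sub>R v + t *\<^sub>R w)"
      by (metis add.assoc add_diff_cancel_left' dist_commute dist_norm)
    also have "\<dots> \<le> s * norm v + t * norm w"
      using norm_triangle_ineq[of "s *\<^sub>R v" "t *\<^sub>R w"] that by simp
    also have "\<dots> \<le> h * norm v + h * norm w"
      by (intro add_mono mult_right_mono that norm_ge_zero)
    finally show ?thesis by (simp add: algebra_simps)
  qed
  then have inb: "p + s *\<^sub>R v + t *\<^sub>R w \<in> ball p r" if "0 \<le> s" "s \<le> h" "0 \<le> t" "t \<le> h" for s t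
    using h(2) that by fastforce
  \<comment> \<open>The increment along \<open>w\<close> as a function of the position along
    \<open>v\<close>; the second difference is the increment of \<open>g\<close> over
    \<open>[0, h]\<close>.\<close>
  define g where "g s = f (p + h *\<^sub>R w + s *\<^sub>R v) - f (p + s *\<^sub>R v)" for s
  have "(g has_real_derivative ddir v f (p + h *\<^sub>R w + s *\<^sub>R v) - ddir v f (p + s *\<^sub>R v)) (at s)"
    if "0 \<le> s" "s \<le> h" for s
    unfolding g_def
    using inb[of s h] inb[of s 0] that h
    by (intro DERIV_diff DERIV_along_line[OF f]) (auto simp: add_ac)
  from MVT2[OF h(1) this] obtain s where s: "0 < s" "s < h"
    "g h - g 0 = (h - 0) * (ddir v f (p + h *\<^sub>R w + s *\<^sub>R v) - ddir v f (p + s *\<^sub>R v))" by blast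
  have "((\<lambda>t. ddir v f (p + s *\<^sub>R v + t *\<^sub>R w)) has_real_derivative
      ddir w (ddir v f) (p + s *\<^sub>R v + t *\<^sub>R w)) (at t)" if "0 \<le> t" "t \<le> h" for t
    by (rule DERIV_along_line[OF smooth_on_ddir[OF f]]) (use inb that s in auto)
  from MVT2[OF h(1) this] obtain t where t: "0 < t" "t < h"
    "ddir v f (p + s *\<^sub>R v + h *\<^sub>R w) - ddir v f (p + s *\<^sub>R v + 0 *\<^sub>R w) =
     (h - 0) * ddir w (ddir v f) (p + s *\<^sub>R v + t *\<^sub>R w)" by blast
  show ?thesis
  proof (intro exI conjI)
    show "dist p (p + s *\<^sub>R v + t *\<^sub>R w) \<le> h * (norm v + norm w)" using close s t by simp
    then show "dist p (p + s *\<^sub>R v + t *\<^sub>R w) < r" using h by simp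
    have "f (p + h *\<^sub>R v + h *\<^sub>R w) - f (p + h *\<^sub>R v) - f (p + h *\<^sub>R w) + f p = g h - g 0"
      by (simp add: g_def add_ac)
    also have "\<dots> = h * (h * ddir w (ddir v f) (p + s *\<^sub>R v + t *\<^sub>R w))"
      using s(3) t(3) by (simp add: add_ac)
    finally show "f (p + h *\<^sub>R v + h *\<^sub>R w) - f (p + h *\<^sub>R v) - f (p + h *\<^sub>R w) + f p =
        h\<^sup>2 * ddir w (ddir v f) (p + s *\<^sub>R v + t *\<^sub>R w)"
      by (simp add: power2_eq_square)
  qed
qed

text \<open>The same second difference, divided by the square of \<open>h\<close>, equals each of
  the two mixed derivatives at some point close to \<open>p\<close>. Both are continuous at
  \<open>p\<close>, so they agree there.\<close>

lemma ddir_commute: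
  fixes f :: "'a::real_normed_vector \<Rightarrow> real"
  assumes U: "open U" and f: "smooth_on U f" and p: "p \<in> U"
  shows "ddir v (ddir w f) p = ddir w (ddir v f) p"
proof (rule ccontr)
  assume ne: "ddir v (ddir w f) p \<noteq> ddir w (ddir v f) p"
  define \<epsilon> where "\<epsilon> = \<bar>ddir v (ddir w f) p - ddir w (ddir v f) p\<bar> / 2"
  have "\<epsilon> > 0" using ne by (simp add: \<epsilon>_def)
  have c: "isCont (ddir v (ddir w f)) p" "isCont (ddir w (ddir v f)) p"
    using smooth_on_isCont[OF _ p] smooth_on_ddir f by blast+
  obtain r where r: "r > 0" "ball p r \<subseteq> U" using U p open_contains_ball by blast
  obtain d1 where d1: "d1 > 0" "\<And>q. dist p q < d1 \<Longrightarrow> \<bar>ddir v (ddir w f) q - ddir v (ddir w f) p\<bar> < \<epsilon>"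
    using c(1) \<open>\<epsilon> > 0\<close> unfolding continuous_at_eps_delta dist_real_def by (metis dist_commute)
  obtain d2 where d2: "d2 > 0" "\<And>q. dist p q < d2 \<Longrightarrow> \<bar>ddir w (ddir v f) q - ddir w (ddir v f) p\<bar> < \<epsilon>"
    using c(2) \<open>\<epsilon> > 0\<close> unfolding continuous_at_eps_delta dist_real_def by (metis dist_commute)
  define m where "m = min r (min d1 d2)"
  have m: "m > 0" using r d1 d2 by (simp add: m_def)
  \<comment> \<open>The summand 1 keeps the denominator positive and makes
    \<open>h * (norm v + norm w)\<close> strictly less than \<open>m\<close>. Both mean value points
    then lie where each mixed derivative is within \<open>\<epsilon>\<close>, half the supposed gap,
    of its value at \<open>p\<close>.\<close>
  define h where "h = m / (norm v + norm w + 1)"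
  have pos: "norm v + norm w + 1 > 0" by (simp add: add_nonneg_pos)
  then have h: "h > 0" "h * (norm v + norm w) < m"
    using m pos mult_strict_left_mono[of "norm v + norm w" "norm v + norm w + 1" m]
    by (simp_all add: h_def field_simps)
  have fb: "smooth_on (ball p r) f" using f r smooth_on_subset by blast
  have hr: "h * (norm v + norm w) < r" "h * (norm w + norm v) < r"
    using h by (auto simp: m_def add.commute)
  obtain q where q: "dist p q \<le> h * (norm v + norm w)"
    "f (p + h *\<^sub>R v + h *\<^sub>R w) - f (p + h *\<^sub>R v) - f (p + h *\<^sub>R w) + f p = h\<^sup>2 * ddir w (ddir v f) q"
    using second_difference[OF fb h(1) hr(1)] by blast
  obtain q' where q': "dist p q' \<le> h * (norm w + norm v)"
    "f (p + h *\<^sub>R w + h *\<^sub>R v) - f (p + h *\<^sub>R w) - f (p + h *\<^sub>R v) + f p = h\<^sup>2 * ddir v (ddir w f) q'"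
    using second_difference[OF fb h(1) hr(2)] by blast
  have "h\<^sup>2 * ddir w (ddir v f) q = h\<^sup>2 * ddir v (ddir w f) q'"
    using q(2) q'(2) by (simp add: algebra_simps)
  then have "ddir w (ddir v f) q = ddir v (ddir w f) q'" using h(1) by simp
  moreover have "\<bar>ddir w (ddir v f) q - ddir w (ddir v f) p\<bar> < \<epsilon>"
    using d2(2)[of q] q(1) h(2) by (simp add: m_def)
  moreover have "\<bar>ddir v (ddir w f) q' - ddir v (ddir w f) p\<bar> < \<epsilon>"
    using d1(2)[of q'] q'(1) h(2) by (simp add: m_def add.commute)
  ultimately show False unfolding \<epsilon>_def by argo
qed

section \<open>Contact of lines with a graph\<close>

lemma line_through_eqD:
  assumes "line_through p v = line_through p w" "v \<noteq> 0"
  obtains c where "c \<noteq> 0" "v = c *\<^sub>R w"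
proof -
  have "p + 1 *\<^sub>R v \<in> line_through p w" using assms(1) unfolding line_through_def by blast
  then obtain c where "p + 1 *\<^sub>R v = p + c *\<^sub>R w" unfolding line_through_def by blast
  then have "v = c *\<^sub>R w" by simp
  then show thesis using that[of c] assms(2) by auto
qed

lemma line_through_scale:
  assumes "c \<noteq> 0"
  shows "line_through p (c *\<^sub>R w) = line_through p w"
proof -
  have "p + t *\<^sub>R w \<in> range (\<lambda>t. p + t *\<^sub>R c *\<^sub>R w)" for t
    by (rule image_eqI[of _ _ "t / c"]) (use assms in auto)
  then show ?thesis unfolding line_through_def by auto
qed

lemma ddir_scale_funpow:
  fixes f :: "'a::real_normed_vector \<Rightarrow> real"
  assumes U: "open U" and f: "smooth_on U f" and x: "x \<in> U"
  shows "(ddir (c *\<^sub>R v) ^^ j) f x = c ^ j * (ddir v ^^ j) f x"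
  using x
proof (induction j arbitrary: x)
  case 0
  then show ?case by simp
next
  case (Suc j)
  have h: "smooth_on U ((ddir v ^^ j) f)" using smooth_on_ddir_funpow f by blast
  have "(ddir (c *\<^sub>R v) ^^ Suc j) f x = ddir (c *\<^sub>R v) (\<lambda>x. c ^ j * (ddir v ^^ j) f x) x"
    using ddir_cong[OF U smooth_on_ddir_funpow[OF f] Suc.IH Suc.prems] by simp
  also have "\<dots> = c ^ j * ddir (c *\<^sub>R v) ((ddir v ^^ j) f) x"
    by (rule ddir_eqI, rule has_derivative_mult_right, rule smooth_on_has_derivative[OF h Suc.prems])
  also have "ddir (c *\<^sub>R v) ((ddir v ^^ j) f) x = c * ddir v ((ddir v ^^ j) f) x"
    by (simp add: linear_scale[OF linear_ddir[OF h Suc.prems]])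
  finally show ?case by simp
qed

text \<open>Here \<open>\<phi> j\<close> and \<open>\<psi> j\<close> are the j-th derivatives of
  \<open>\<phi> 0\<close> and \<open>\<psi> 0\<close>. If \<open>\<phi> j\<close> were the first one
  not vanishing at 0, then \<open>\<phi> 0 x\<close> would be of exact order \<open>x ^ j\<close>
  and \<open>\<psi> 0 x\<close> of smaller order, against the bound.\<close>

lemma vanishing_derivatives_transfer:
  fixes \<phi> \<psi> :: "nat \<Rightarrow> real \<Rightarrow> real"
  assumes r: "r > 0"
    and \<phi>: "\<And>j t. \<bar>t\<bar> < r \<Longrightarrow> (\<phi> j has_real_derivative \<phi> (Suc j) t) (at t)"
    and \<psi>: "\<And>j t. \<bar>t\<bar> < r \<Longrightarrow> (\<psi> j has_real_derivative \<psi> (Suc j) t) (at t)"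
    and bound: "\<And>t. \<bar>t\<bar> < r \<Longrightarrow> \<bar>\<phi> 0 t\<bar> \<le> K * \<bar>\<psi> 0 t\<bar>"
    and \<psi>0: "\<And>j. j \<le> k \<Longrightarrow> \<psi> j 0 = 0"
    and j: "j \<le> k"
  shows "\<phi> j 0 = 0"
  using j
proof (induction j rule: less_induct)
  case (less j)
  show ?case
  proof (rule ccontr)
    assume ne: "\<phi> j 0 \<noteq> 0"
    \<comment> \<open>Maclaurin's formula with Lagrange remainder: all terms below order
      \<open>j\<close> vanish, and only the remainder is left.\<close>
    have taylor: "\<exists>t. \<bar>t\<bar> \<le> \<bar>x\<bar> \<and> \<xi> 0 x = \<xi> j t / fact j * x ^ j"
      if d: "\<And>j t. \<bar>t\<bar> < r \<Longrightarrow> (\<xi> j has_real_derivative \<xi> (Suc j) t) (at t)"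
        and z: "\<And>i. i < j \<Longrightarrow> \<xi> i 0 = 0" and x: "\<bar>x\<bar> < r" for \<xi> :: "nat \<Rightarrow> real \<Rightarrow> real" and x
    proof -
      have "\<exists>t. \<bar>t\<bar> \<le> \<bar>x\<bar> \<and> \<xi> 0 x = (\<Sum>m<j. \<xi> m 0 / fact m * x ^ m) + \<xi> j t / fact j * x ^ j"
        by (rule Maclaurin_bi_le) (use d x in auto)
      then show ?thesis using z by simp
    qed
    define \<epsilon> where "\<epsilon> = \<bar>\<phi> j 0\<bar> / 2"
    have "\<epsilon> > 0" using ne by (simp add: \<epsilon>_def)
    have "isCont (\<phi> j) 0" "isCont (\<psi> j) 0"
      using \<phi>[of 0] \<psi>[of 0] r DERIV_isCont by (metis abs_zero)+
    then have "isCont (\<phi> j) 0" "isCont (\<lambda>t. K * \<bar>\<psi> j t\<bar>) 0"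
      by (auto intro: continuous_intros)
    then obtain d1 d2 where d: "d1 > 0" "\<And>t. \<bar>t\<bar> < d1 \<Longrightarrow> \<bar>\<phi> j t - \<phi> j 0\<bar> < \<epsilon>"
        "d2 > 0" "\<And>t. \<bar>t\<bar> < d2 \<Longrightarrow> \<bar>K * \<bar>\<psi> j t\<bar> - K * \<bar>\<psi> j 0\<bar>\<bar> < \<epsilon>"
      using \<open>\<epsilon> > 0\<close> unfolding continuous_at_eps_delta by (auto simp: dist_real_def) metis
    define x where "x = min r (min d1 d2) / 2"
    have x: "x > 0" "x < r" "x < d1" "x < d2" using r d(1,3) by (auto simp: x_def)
    obtain t where t: "\<bar>t\<bar> \<le> x" "\<phi> 0 x = \<phi> j t / fact j * x ^ j"
      using taylor[of \<phi> x] \<phi> less x by auto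
    obtain s where s: "\<bar>s\<bar> \<le> x" "\<psi> 0 x = \<psi> j s / fact j * x ^ j"
      using taylor[of \<psi> x] \<psi> \<psi>0 less.prems x by auto
    \<comment> \<open>Both remainders carry the factor \<open>x ^ j / fact j\<close>; cancelling it
      turns the bound on values into a bound on j-th derivatives near 0.\<close>
    have "\<bar>\<phi> j t\<bar> * (x ^ j / fact j) \<le> (K * \<bar>\<psi> j s\<bar>) * (x ^ j / fact j)"
      using bound[of x] x unfolding t s by (simp add: abs_mult)
    then have "\<bar>\<phi> j t\<bar> \<le> K * \<bar>\<psi> j s\<bar>"
      by (rule mult_right_le_imp_le) (use x in simp)
    moreover have "\<bar>\<phi> j t\<bar> > \<epsilon>" using d(2)[of t] t(1) x(3) unfolding \<epsilon>_def by linarith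
    moreover have "K * \<bar>\<psi> j s\<bar> < \<epsilon>" using d(4)[of s] s(1) x(4) \<psi>0[OF less.prems] by auto
    ultimately show False by linarith
  qed
qed

section \<open>Surfaces given locally as graphs\<close>

locale graph_chart =
  fixes S W :: "(real^3) set" and U :: "(real \<times> real) set" and F :: "real \<times> real \<Rightarrow> real"
  assumes open_U: "open U" and smooth_F: "smooth_on U F" and open_W: "open W"
    and graph: "S \<inter> W = {q \<in> W. (q $ 1, q $ 2) \<in> U \<and> q $ 3 = F (q $ 1, q $ 2)}"
begin

definition xy :: "real^3 \<Rightarrow> real \<times> real" where "xy q = (q $ 1, q $ 2)"
text \<open>The Monge equation, considered on the whole cylinder \<open>U3\<close> over
  \<open>U\<close>. Its derivative along the third axis is -1 everywhere, which makes it a local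
  equation at every point of \<open>S\<close> in \<open>W\<close>.\<close>

definition G :: "real^3 \<Rightarrow> real" where "G q = F (xy q) - q $ 3"
definition U3 :: "(real^3) set" where "U3 = xy -` U"

lemma bounded_linear_xy: "bounded_linear xy"
  unfolding xy_def by (intro bounded_linear_Pair bounded_linear_vec_nth)

lemma xy_simps [simp]: "xy (p + v) = xy p + xy v" "xy (t *\<^sub>R v) = t *\<^sub>R xy v"
  by (auto simp: xy_def)

lemma isCont_xy: "isCont xy p"
  using bounded_linear_xy by (simp add: linear_continuous_at)

lemma open_U3: "open U3"
  unfolding U3_def by (rule open_vimage[OF open_U]) (use bounded_linear_xy in \<open>simp add: linear_continuous_on\<close>)

lemma smooth_G: "smooth_on U3 G"
  unfolding smooth_on_def G_def
proof
  fix k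
  have "Ck_on k U3 (\<lambda>q. F (xy q))"
    using Ck_on_compose_linear[OF open_U bounded_linear_xy] smooth_F
    unfolding smooth_on_def U3_def by blast
  then show "Ck_on k U3 (\<lambda>q. F (xy q) - q $ 3)"
    by (intro Ck_on_diff[OF open_U3]) (auto intro: Ck_on_bounded_linear bounded_linear_vec_nth)
qed

lemma mem_chart: "q \<in> W \<Longrightarrow> q \<in> S \<longleftrightarrow> xy q \<in> U \<and> q $ 3 = F (xy q)"
  using graph unfolding xy_def by blast

lemma has_derivative_comp_xy:
  fixes H :: "real \<times> real \<Rightarrow> 'b::real_normed_vector"
  assumes "smooth_on U H" "q \<in> U3"
  shows "((\<lambda>q. H (xy q)) has_derivative (\<lambda>w. ddir (xy w) H (xy q))) (at q)"
proof -
  have "xy q \<in> U" using assms by (simp add: U3_def)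
  from has_derivative_compose[OF bounded_linear_imp_has_derivative[OF bounded_linear_xy]
      smooth_on_has_derivative[OF assms(1) this]]
  show ?thesis .
qed

lemma ddir_G: "q \<in> U3 \<Longrightarrow> ddir v G q = ddir (xy v) F (xy q) - v $ 3"
proof (rule ddir_eqI)
  assume q: "q \<in> U3"
  have "((\<lambda>q. F (xy q)) has_derivative (\<lambda>v. ddir (xy v) F (xy q))) (at q)"
    by (rule has_derivative_comp_xy[OF smooth_F q])
  then show "(G has_derivative (\<lambda>v. ddir (xy v) F (xy q) - v $ 3)) (at q)"
    unfolding G_def
    by (rule has_derivative_diff)
      (rule bounded_linear_imp_has_derivative[OF bounded_linear_vec_nth])
qed

text \<open>The height enters \<open>G\<close> linearly, so it contributes to the first derivative
  only.\<close>

lemma ddir_G_funpow: 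
  "q \<in> U3 \<Longrightarrow> (ddir v ^^ Suc j) G q = (ddir (xy v) ^^ Suc j) F (xy q) - (if j = 0 then v $ 3 else 0)"
proof (induction j arbitrary: q)
  case 0
  then show ?case by (simp add: ddir_G)
next
  case (Suc j)
  have "(ddir v ^^ Suc (Suc j)) G q =
      ddir v (\<lambda>q. (ddir (xy v) ^^ Suc j) F (xy q) - (if j = 0 then v $ 3 else 0)) q"
    using ddir_cong[OF open_U3 smooth_on_ddir_funpow[OF smooth_G] Suc.IH Suc.prems, of v] by simp
  also have "\<dots> = ddir (xy v) ((ddir (xy v) ^^ Suc j) F) (xy q)"
  proof -
    have "((\<lambda>q. (ddir (xy v) ^^ Suc j) F (xy q)) has_derivative
       (\<lambda>w. ddir (xy w) ((ddir (xy v) ^^ Suc j) F) (xy q))) (at q)"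
      by (rule has_derivative_comp_xy[OF smooth_on_ddir_funpow[OF smooth_F] Suc.prems])
    from ddir_eqI[OF has_derivative_diff[OF this has_derivative_const]]
    show ?thesis by simp
  qed
  finally show ?case by simp
qed

lemma local_equation_G:
  assumes "q \<in> S" "q \<in> W"
  shows "local_equation S q (W \<inter> U3) G"
proof -
  have q: "q \<in> U3" using assms mem_chart by (auto simp: U3_def)
  have "frechet_derivative G (at q) (axis 3 1) = -1"
    using ddir_G[OF q, of "axis 3 1"] linear_0[OF linear_ddir[OF smooth_F, of "xy q"]] q
    unfolding ddir_def U3_def by (simp add: xy_def axis_def zero_prod_def)
  then have "frechet_derivative G (at q) \<noteq> (\<lambda>_. 0)" by (metis neg_equal_0_iff_equal zero_neq_one)
  moreover have "S \<inter> (W \<inter> U3) = {q \<in> W \<inter> U3. G q = 0}"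
    using mem_chart unfolding U3_def G_def by auto
  ultimately show ?thesis
    unfolding local_equation_def
    using assms q open_W open_U3 smooth_on_subset[OF smooth_G] by auto
qed

text \<open>Vertical projection onto the graph of \<open>F\<close>.\<close>

definition lift :: "real^3 \<Rightarrow> real^3" where
  "lift q = q + G q *\<^sub>R axis 3 1"

lemma lift_nth: "lift q $ 1 = q $ 1" "lift q $ 2 = q $ 2" "lift q $ 3 = F (xy q)"
  by (auto simp: lift_def axis_def G_def)

lemma xy_lift [simp]: "xy (lift q) = xy q"
  by (simp add: xy_def lift_nth)

lemma lift_mem: "lift q \<in> W \<Longrightarrow> q \<in> U3 \<Longrightarrow> lift q \<in> S"
  by (simp add: mem_chart lift_nth U3_def)

lemma has_derivative_lift:
  "q \<in> U3 \<Longrightarrow> (lift has_derivative (\<lambda>w. w + ddir w G q *\<^sub>R axis 3 1)) (at q)"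
  unfolding lift_def
  by (intro has_derivative_add has_derivative_ident has_derivative_scaleR_left
      smooth_on_has_derivative[OF smooth_G])

text \<open>\<open>g\<close> vanishes at \<open>lift q\<close>. By the mean value theorem on the
  vertical segment from \<open>q\<close> to \<open>lift q\<close>, of signed length
  \<open>G q\<close>, the absolute value of \<open>g q\<close> is that of \<open>G q\<close> times a
  vertical derivative of \<open>g\<close>, which is bounded away from 0 near
  \<open>p\<close>.\<close>

lemma local_equation_bound:
  assumes g: "local_equation S p V g" and p: "p \<in> S" "p \<in> W"
  obtains K d where "d > 0" "\<And>q. dist p q < d \<Longrightarrow> \<bar>G q\<bar> \<le> K * \<bar>g q\<bar>"
proof -
  have V: "open V" "p \<in> V" "smooth_on V g" "frechet_derivative g (at p) \<noteq> (\<lambda>_. 0)"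
      "S \<inter> V = {q \<in> V. g q = 0}"
    using g unfolding local_equation_def by auto
  have pU: "p \<in> U3" and G0: "G p = 0" using p mem_chart by (auto simp: U3_def G_def)
  have lift_p: "lift p = p" by (simp add: lift_def G0)
  define e3 :: "real^3" where "e3 = axis 3 1"
  have op: "open (V \<inter> W \<inter> U3)" "p \<in> V \<inter> W \<inter> U3"
    using V open_W open_U3 p pU by auto
  have lim: "(lift \<longlongrightarrow> p) (nhds p)"
    using has_derivative_continuous[OF has_derivative_lift[OF pU]] lift_p
    by (metis continuous_within tendsto_at_iff_tendsto_nhds)
  have zero: "g (lift q) = 0" if "q \<in> U3" "lift q \<in> V \<inter> W \<inter> U3" for q
    using lift_mem[OF _ that(1)] that V(5) by blast
  \<comment> \<open>The composite of \<open>g\<close> with \<open>lift\<close> is zero near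
    \<open>p\<close>. If the vertical derivative of \<open>g\<close> vanished at \<open>p\<close>,
    the chain rule would make every derivative of \<open>g\<close> at \<open>p\<close> vanish,
    against the regularity of a local equation.\<close>
  have "ddir e3 g p \<noteq> 0"
  proof
    assume e: "ddir e3 g p = 0"
    have "ddir w g p = 0" for w
    proof -
      have "((\<lambda>q. g (lift q)) has_derivative (\<lambda>w. ddir (w + ddir w G p *\<^sub>R e3) g p)) (at p)"
        using has_derivative_compose[OF has_derivative_lift[OF pU], of g "\<lambda>v. ddir v g p"]
          smooth_on_has_derivative[OF V(3,2)] unfolding lift_p e3_def by blast
      moreover have "eventually (\<lambda>q. q \<in> U3) (nhds p)"
        by (rule eventually_nhds_in_open[OF open_U3 pU])
      then have "eventually (\<lambda>q. g (lift q) = 0) (nhds p)"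
        using topological_tendstoD[OF lim op] by eventually_elim (use zero in blast)
      then have "((\<lambda>q. g (lift q)) has_derivative (\<lambda>w. 0)) (at p)"
        by (intro has_derivative_transform_eventually[OF has_derivative_const[of 0]])
          (auto simp: eventually_at_filter dest: eventually_nhds_x_imp_x elim: eventually_mono)
      ultimately have "(\<lambda>w. ddir (w + ddir w G p *\<^sub>R e3) g p) = (\<lambda>w. 0)"
        by (rule has_derivative_unique)
      then have "ddir (w + ddir w G p *\<^sub>R e3) g p = 0" by meson
      then show ?thesis
        using e linear_add[OF linear_ddir[OF V(3,2)]] linear_scale[OF linear_ddir[OF V(3,2)]] by simp
    qed
    then show False using V(4) unfolding ddir_def by auto
  qed
  define m where "m = \<bar>ddir e3 g p\<bar> / 2"
  have m: "m > 0" using \<open>ddir e3 g p \<noteq> 0\<close> by (simp add: m_def)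
  obtain d1 where d1: "d1 > 0" "\<And>q. dist p q < d1 \<Longrightarrow> \<bar>ddir e3 g q - ddir e3 g p\<bar> < m"
    using smooth_on_isCont[OF smooth_on_ddir[OF V(3)] V(2)] m
    unfolding continuous_at_eps_delta dist_real_def by (metis dist_commute)
  obtain d2 where d2: "d2 > 0" "ball p d2 \<subseteq> V \<inter> W \<inter> U3" using op open_contains_ball by blast
  define r where "r = min d1 d2"
  have r: "r > 0" using d1 d2 by (simp add: r_def)
  have big: "m \<le> \<bar>ddir e3 g q\<bar>" if "q \<in> ball p r" for q
    using d1(2)[of q] that abs_triangle_ineq2_sym[of "ddir e3 g p" "ddir e3 g q"]
    unfolding r_def m_def by auto
  have "eventually (\<lambda>q. lift q \<in> ball p r) (nhds p)"
    using topological_tendstoD[OF lim open_ball] r by simp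
  then obtain d3 where d3: "d3 > 0" "\<And>q. dist p q < d3 \<Longrightarrow> lift q \<in> ball p r"
    unfolding eventually_nhds_metric by (metis dist_commute)
  show thesis
  proof (rule that)
    show "min r d3 > 0" using r d3 by simp
    fix q assume "dist p q < min r d3"
    then have q: "q \<in> ball p r" "lift q \<in> ball p r" using d3 by auto
    have seg: "q + s *\<^sub>R (G q *\<^sub>R e3) \<in> ball p r" if "0 \<le> s" "s \<le> 1" for s
    proof -
      have "q + s *\<^sub>R (G q *\<^sub>R e3) = (1 - s) *\<^sub>R q + s *\<^sub>R lift q"
        unfolding lift_def e3_def by (simp add: algebra_simps)
      then show ?thesis
        using convexD[OF convex_ball q, of "1 - s" s] that by simp
    qed
    have sub: "ball p r \<subseteq> V \<inter> W \<inter> U3" using d2 by (auto simp: r_def)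
    have "((\<lambda>s. g (q + s *\<^sub>R (G q *\<^sub>R e3))) has_real_derivative
        ddir (G q *\<^sub>R e3) g (q + s *\<^sub>R (G q *\<^sub>R e3))) (at s)" if "0 \<le> s" "s \<le> 1" for s
      by (rule DERIV_along_line[OF V(3)]) (use seg[OF that] sub in blast)
    from MVT2[OF zero_less_one this] obtain s where s: "0 < s" "s < 1"
      "g (q + 1 *\<^sub>R (G q *\<^sub>R e3)) - g (q + 0 *\<^sub>R (G q *\<^sub>R e3)) =
        (1 - 0) * ddir (G q *\<^sub>R e3) g (q + s *\<^sub>R (G q *\<^sub>R e3))" by blast
    define z where "z = q + s *\<^sub>R (G q *\<^sub>R e3)"
    have z: "z \<in> ball p r" "z \<in> V" using seg[of s] s sub unfolding z_def by auto
    have "g (lift q) - g q = G q * ddir e3 g z"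
      using s(3) linear_scale[OF linear_ddir[OF V(3) z(2)]] unfolding z_def[symmetric]
      by (simp add: lift_def e3_def)
    moreover have "g (lift q) = 0" using zero q sub by blast
    ultimately have "\<bar>g q\<bar> = \<bar>G q\<bar> * \<bar>ddir e3 g z\<bar>" by (metis abs_mult abs_minus diff_0)
    then have "\<bar>G q\<bar> * m \<le> \<bar>g q\<bar>" using mult_left_mono[OF big[OF z(1)], of "\<bar>G q\<bar>"] by simp
    then show "\<bar>G q\<bar> \<le> (1 / m) * \<bar>g q\<bar>" using m by (simp add: field_simps)
  qed
qed

text \<open>For one direction \<open>G\<close> itself serves as the local equation. For the other,
  the local equation \<open>g\<close> provided by the contact bounds \<open>G\<close> near
  \<open>q\<close>, so the vanishing of its derivatives along the line passes to
  \<open>G\<close>.\<close>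

lemma contact_iff:
  assumes q: "q \<in> S" "q \<in> W" and v: "v \<noteq> 0"
  shows "contact_more_than k S q (line_through q v) \<longleftrightarrow> (\<forall>j\<le>k. (ddir v ^^ j) G q = 0)"
proof
  have qU: "q \<in> U3" using q mem_chart by (auto simp: U3_def)
  {
    assume "\<forall>j\<le>k. (ddir v ^^ j) G q = 0"
    then have "\<forall>j\<le>k. (deriv ^^ j) (\<lambda>t. G (q + t *\<^sub>R v)) 0 = 0"
      using higher_deriv_along_line[OF open_U3 smooth_G, of q 0 v] qU by simp
    then show "contact_more_than k S q (line_through q v)"
      unfolding contact_more_than_def using local_equation_G[OF q] v by blast
  }
  assume "contact_more_than k S q (line_through q v)"
  then obtain v' V g where v': "v' \<noteq> 0" "line_through q v = line_through q v'"
    and g: "local_equation S q V g" and z: "\<And>j. j \<le> k \<Longrightarrow> (deriv ^^ j) (\<lambda>t. g (q + t *\<^sub>R v')) 0 = 0"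
    unfolding contact_more_than_def by blast
  have V: "open V" "q \<in> V" "smooth_on V g" using g unfolding local_equation_def by auto
  \<comment> \<open>The contact may be witnessed by another direction vector of the same line; this
    only multiplies the j-th derivative by a power of \<open>c\<close>.\<close>
  obtain c where c: "v = c *\<^sub>R v'" using line_through_eqD[OF v'(2) v] by blast
  have g0: "(ddir v ^^ j) g q = 0" if "j \<le> k" for j
    using z[OF that] higher_deriv_along_line[OF V(1,3), of q 0 v' j] V(2)
    unfolding c ddir_scale_funpow[OF V(1,3,2)] by simp
  obtain K d where d: "d > 0" "\<And>p. dist q p < d \<Longrightarrow> \<bar>G p\<bar> \<le> K * \<bar>g p\<bar>"
    using local_equation_bound[OF g q] by blast
  have "open (V \<inter> U3 \<inter> ball q d)" "q + 0 *\<^sub>R v \<in> V \<inter> U3 \<inter> ball q d"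
    using V open_U3 qU d by auto
  from eventually_on_line[OF this] obtain r where
    r: "r > 0" "\<And>t. \<bar>t\<bar> < r \<Longrightarrow> q + t *\<^sub>R v \<in> V \<inter> U3 \<inter> ball q d"
    unfolding eventually_nhds_metric dist_real_def by auto
  show "\<forall>j\<le>k. (ddir v ^^ j) G q = 0"
  proof (intro allI impI)
    fix j assume j: "j \<le> k"
    have "(\<lambda>j t. (ddir v ^^ j) G (q + t *\<^sub>R v)) j 0 = 0"
    proof (rule vanishing_derivatives_transfer[OF r(1) _ _ _ _ j])
      fix i and t :: real assume t: "\<bar>t\<bar> < r"
      show "((\<lambda>t. (ddir v ^^ i) G (q + t *\<^sub>R v)) has_real_derivative
          (ddir v ^^ Suc i) G (q + t *\<^sub>R v)) (at t)"
        using DERIV_along_line[OF smooth_on_ddir_funpow[OF smooth_G]] r(2)[OF t] by simp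
      show "((\<lambda>t. (ddir v ^^ i) g (q + t *\<^sub>R v)) has_real_derivative
          (ddir v ^^ Suc i) g (q + t *\<^sub>R v)) (at t)"
        using DERIV_along_line[OF smooth_on_ddir_funpow[OF V(3)]] r(2)[OF t] by simp
      show "\<bar>(ddir v ^^ 0) G (q + t *\<^sub>R v)\<bar> \<le> K * \<bar>(ddir v ^^ 0) g (q + t *\<^sub>R v)\<bar>"
        using d(2) r(2)[OF t] by simp
    next
      fix i assume "i \<le> k"
      then show "(ddir v ^^ i) g (q + 0 *\<^sub>R v) = 0" using g0 by simp
    qed
    then show "(ddir v ^^ j) G q = 0" by simp
  qed
qed

end

section \<open>Asymptotic directions and frames in terms of partial derivatives\<close>

abbreviation D1 :: "(real \<times> real \<Rightarrow> real) \<Rightarrow> real \<times> real \<Rightarrow> real" where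
  "D1 \<equiv> ddir (1, 0)"

abbreviation D2 :: "(real \<times> real \<Rightarrow> real) \<Rightarrow> real \<times> real \<Rightarrow> real" where
  "D2 \<equiv> ddir (0, 1)"

lemma ddir_pair:
  assumes "smooth_on U H" "p \<in> U"
  shows "ddir (a, b) H p = a * D1 H p + b * D2 H p"
proof -
  have "ddir (a *\<^sub>R (1, 0) + b *\<^sub>R (0, 1)) H p = a * D1 H p + b * D2 H p"
    by (simp only: linear_add[OF linear_ddir[OF assms]] linear_scale[OF linear_ddir[OF assms]]
        real_scaleR_def)
  then show ?thesis by simp
qed

lemma ddir_linear_combination:
  fixes H K L :: "'a::real_normed_vector \<Rightarrow> real"
  assumes "smooth_on U H" "smooth_on U K" "smooth_on U L" "p \<in> U"
  shows "ddir w (\<lambda>p. a * H p + b * K p + c * L p) p = a * ddir w H p + b * ddir w K p + c * ddir w L p"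
proof -
  note d = smooth_on_has_derivative[OF assms(1,4)] smooth_on_has_derivative[OF assms(2,4)]
    smooth_on_has_derivative[OF assms(3,4)]
  have "((\<lambda>p. a * H p + b * K p + c * L p) has_derivative
      (\<lambda>w. a * ddir w H p + b * ddir w K p + c * ddir w L p)) (at p)"
    by (intro has_derivative_add has_derivative_mult_right d)
  from ddir_eqI[OF this] show ?thesis .
qed

text \<open>The inner derivatives in \<open>y\<close> are identified only for \<open>x\<close> near
  0, where \<open>(x, 0)\<close> lies in \<open>U\<close>; this suffices for the outer derivatives
  at 0.\<close>

lemma partial0_eq_ddir:
  fixes F :: "real \<times> real \<Rightarrow> real"
  assumes U: "open U" "(0, 0) \<in> U" and F: "smooth_on U F"
  shows "partial0 i j (\<lambda>x y. F (x, y)) = (D1 ^^ i) ((D2 ^^ j) F) (0, 0)"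
proof -
  have y: "(deriv ^^ j) (\<lambda>y. F (x, y)) 0 = (D2 ^^ j) F (x, 0)" if "(x, 0) \<in> U" for x
    using higher_deriv_along_line[OF U(1) F, of "(x, 0)" 0 "(0, 1)" j] that by simp
  have "eventually (\<lambda>x. (deriv ^^ j) (\<lambda>y. F (x, y)) 0 = (D2 ^^ j) F (x, 0)) (nhds 0)"
    using eventually_on_line[OF U(1), of "(0, 0)" 0 "(1, 0)"] U(2)
    by (auto elim!: eventually_mono intro: y)
  then have "partial0 i j (\<lambda>x y. F (x, y)) = (deriv ^^ i) (\<lambda>x. (D2 ^^ j) F (x, 0)) 0"
    unfolding partial0_def by (rule higher_deriv_cong_ev) simp
  also have "\<dots> = (D1 ^^ i) ((D2 ^^ j) F) (0, 0)"
    using higher_deriv_along_line[OF U(1) smooth_on_ddir_funpow[OF F, of j "(0, 1)"],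
        of "(0, 0)" 0 "(1, 0)" i] U(2) by simp
  finally show ?thesis .
qed

section \<open>Derivatives of parametrised curves\<close>

lemma smooth_on_has_vector_derivative:
  fixes c :: "real \<Rightarrow> 'a::real_normed_vector"
  assumes "smooth_on I c" "t \<in> I"
  shows "(c has_vector_derivative vector_derivative c (at t)) (at t)"
  using smooth_on_differentiable[OF assms] by (simp add: vector_derivative_works)

lemma smooth_on_vector_derivative:
  fixes c :: "real \<Rightarrow> 'a::real_normed_vector"
  assumes "open I" "smooth_on I c"
  shows "smooth_on I (\<lambda>t. vector_derivative c (at t))"
proof (rule smooth_on_cong[OF assms(1) _ smooth_on_ddir[OF assms(2), of 1]])
  fix t assume "t \<in> I"
  then show "ddir 1 c t = vector_derivative c (at t)"
    using smooth_on_differentiable[OF assms(2)] 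
    by (simp add: ddir_def frechet_derivative_eq_vector_derivative)
qed

lemma smooth_on_nth_vector_derivative:
  "open I \<Longrightarrow> smooth_on I c \<Longrightarrow> smooth_on I (nth_vector_derivative k c)"
  by (induction k) (simp_all add: nth_vector_derivative_def smooth_on_vector_derivative)

lemma nth_vector_derivative_has_vector_derivative:
  assumes "open I" "smooth_on I c" "t \<in> I"
  shows "(nth_vector_derivative k c has_vector_derivative nth_vector_derivative (Suc k) c t) (at t)"
  using smooth_on_has_vector_derivative[OF smooth_on_nth_vector_derivative[OF assms(1,2)] assms(3), of k]
  by (simp add: nth_vector_derivative_def)

lemma has_vector_derivative_vec_nth:
  assumes "(c has_vector_derivative c') (at t)"
  shows "((\<lambda>t. c t $ i) has_real_derivative c' $ i) (at t)"
  using bounded_linear.has_vector_derivative[OF bounded_linear_vec_nth assms]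
  by (simp add: has_real_derivative_iff_has_vector_derivative)

context graph_chart begin

lemma smooth_D [simp]: "smooth_on U ((ddir v ^^ j) F)" "smooth_on U (ddir u F)"
  "smooth_on U (ddir u (ddir v F))" "smooth_on U (ddir u (ddir v (ddir w F)))"
  "smooth_on U F"
  by (intro smooth_on_ddir smooth_on_ddir_funpow smooth_F)+

text \<open>Rewrites mixed partial derivatives to the normal form with all \<open>D1\<close>
  outside, the order used by \<open>partial0\<close>.\<close>

lemma D_commute:
  assumes "p \<in> U"
  shows "D2 (D1 F) p = D1 (D2 F) p"
    and "D2 (D1 (D1 F)) p = D1 (D1 (D2 F)) p"
    and "D2 (D1 (D2 F)) p = D1 (D2 (D2 F)) p"
proof -
  have c: "D2 (D1 F) p = D1 (D2 F) p" if "p \<in> U" for p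
    by (rule ddir_commute[OF open_U smooth_F that])
  show "D2 (D1 F) p = D1 (D2 F) p" by (rule c[OF assms])
  have "D2 (D1 (D1 F)) p = D1 (D2 (D1 F)) p"
    by (rule ddir_commute[OF open_U _ assms]) simp
  also have "\<dots> = D1 (D1 (D2 F)) p"
    by (rule ddir_cong[OF open_U _ c assms]) simp_all
  finally show "D2 (D1 (D1 F)) p = D1 (D1 (D2 F)) p" .
  show "D2 (D1 (D2 F)) p = D1 (D2 (D2 F)) p"
    by (rule ddir_commute[OF open_U _ assms]) simp
qed

lemma D_commute4:
  assumes "p \<in> U"
  shows "D2 (D1 (D1 (D1 F))) p = D1 (D1 (D1 (D2 F))) p"
proof -
  have "D2 (D1 (D1 (D1 F))) p = D1 (D2 (D1 (D1 F))) p"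
    by (rule ddir_commute[OF open_U _ assms]) simp
  also have "\<dots> = D1 (D1 (D1 (D2 F))) p"
    by (rule ddir_cong[OF open_U _ D_commute(2) assms]) simp_all
  finally show ?thesis .
qed

text \<open>The Hessian form of \<open>F\<close> at \<open>p\<close>. Its zeros are the projected
  asymptotic directions; those where the third-order form \<open>cubic\<close> vanishes as well have
  more than 3-point contact.\<close>

definition quad :: "real \<times> real \<Rightarrow> real \<Rightarrow> real \<Rightarrow> real" where
  "quad p a b = a\<^sup>2 * D1 (D1 F) p + 2 * a * b * D1 (D2 F) p + b\<^sup>2 * D2 (D2 F) p"

definition cubic :: "real \<times> real \<Rightarrow> real \<Rightarrow> real \<Rightarrow> real" where
  "cubic p a b = a ^ 3 * D1 (D1 (D1 F)) p + 3 * a\<^sup>2 * b * D1 (D1 (D2 F)) p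
     + 3 * a * b\<^sup>2 * D1 (D2 (D2 F)) p + b ^ 3 * D2 (D2 (D2 F)) p"

lemma ddir2_eq_quad:
  assumes p: "p \<in> U"
  shows "ddir (a, b) (ddir (a, b) F) p = quad p a b"
proof -
  \<comment> \<open>The summand \<open>0 * F p\<close> gives the sum the three-term shape of
    \<open>ddir_linear_combination\<close>.\<close>
  have "ddir (a, b) (ddir (a, b) F) p = ddir (a, b) (\<lambda>p. a * D1 F p + b * D2 F p + 0 * F p) p"
    by (rule ddir_cong[OF open_U _ _ p]) (simp_all add: ddir_pair[OF smooth_F, of _ a b])
  also have "\<dots> = a * ddir (a, b) (D1 F) p + b * ddir (a, b) (D2 F) p + 0 * ddir (a, b) F p"
    by (rule ddir_linear_combination[OF _ _ _ p]) simp_all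
  also have "\<dots> = quad p a b"
    using D_commute(1)[OF p]
    by (simp add: ddir_pair[OF _ p, of _ a b] quad_def algebra_simps power2_eq_square)
  finally show ?thesis .
qed

lemma ddir3_eq_cubic:
  assumes p: "p \<in> U"
  shows "ddir (a, b) (ddir (a, b) (ddir (a, b) F)) p = cubic p a b"
proof -
  have "ddir (a, b) (ddir (a, b) (ddir (a, b) F)) p = ddir (a, b) (\<lambda>p. quad p a b) p"
    by (rule ddir_cong[OF open_U _ ddir2_eq_quad p]) simp_all
  also have "\<dots> = a\<^sup>2 * ddir (a, b) (D1 (D1 F)) p + (2 * a * b) * ddir (a, b) (D1 (D2 F)) p
      + b\<^sup>2 * ddir (a, b) (D2 (D2 F)) p"
    unfolding quad_def by (rule ddir_linear_combination[OF _ _ _ p]) simp_all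
  also have "\<dots> = cubic p a b"
    using D_commute[OF p]
    by (simp add: ddir_pair[OF _ p, of _ a b] cubic_def algebra_simps power2_eq_square power3_eq_cube)
  finally show ?thesis .
qed

lemma G_eq_0: "q \<in> S \<Longrightarrow> q \<in> W \<Longrightarrow> G q = 0"
  using mem_chart by (simp add: G_def)

lemma chart_in_U: "q \<in> S \<Longrightarrow> q \<in> W \<Longrightarrow> xy q \<in> U"
  using mem_chart by simp

lemma contact_1_iff:
  assumes q: "q \<in> S" "q \<in> W" and v: "v \<noteq> 0"
  shows "contact_more_than (Suc 0) S q (line_through q v) \<longleftrightarrow> v $ 3 = ddir (xy v) F (xy q)"
proof -
  have "(\<forall>j\<le>Suc 0. (ddir v ^^ j) G q = 0) \<longleftrightarrow> ddir v G q = 0"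
    using G_eq_0[OF q] by (auto simp: le_Suc_eq)
  then show ?thesis
    using ddir_G[of q v] chart_in_U[OF q] by (auto simp: contact_iff[OF q v] U3_def)
qed

text \<open>From order 2 on the derivatives of \<open>G\<close> are those of \<open>F\<close>, hence
  the shift by two; tangency, at order 1, is \<open>contact_1_iff\<close>.\<close>

lemma contact_Suc_iff:
  assumes q: "q \<in> S" "q \<in> W" and v: "v \<noteq> 0"
  shows "contact_more_than (Suc (Suc k)) S q (line_through q v) \<longleftrightarrow>
    contact_more_than (Suc k) S q (line_through q v) \<and> (ddir (xy v) ^^ Suc (Suc k)) F (xy q) = 0"
proof -
  have "(\<forall>j\<le>Suc (Suc k). (ddir v ^^ j) G q = 0) \<longleftrightarrow>
      (\<forall>j\<le>Suc k. (ddir v ^^ j) G q = 0) \<and> (ddir v ^^ Suc (Suc k)) G q = 0"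
    using le_Suc_eq by metis
  then show ?thesis
    using ddir_G_funpow[of q "Suc k" v] chart_in_U[OF q] by (auto simp: contact_iff[OF q v] U3_def)
qed

lemma asymptotic_line_iff:
  assumes q: "q \<in> S" "q \<in> W" and v: "v \<noteq> 0"
  shows "asymptotic_line S q (line_through q v) \<longleftrightarrow>
    v $ 3 = ddir (xy v) F (xy q) \<and> quad (xy q) (v $ 1) (v $ 2) = 0"
proof -
  have "(ddir (xy v) ^^ Suc (Suc 0)) F (xy q) = quad (xy q) (v $ 1) (v $ 2)"
    using ddir2_eq_quad[OF chart_in_U[OF q]] by (simp add: xy_def)
  then show ?thesis
    unfolding asymptotic_line_def
    using contact_Suc_iff[OF q v, of 0] contact_1_iff[OF q v] by (simp add: numeral_2_eq_2)
qed

lemma contact_3_iff: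
  assumes q: "q \<in> S" "q \<in> W" and v: "v \<noteq> 0"
  shows "contact_more_than 3 S q (line_through q v) \<longleftrightarrow>
    asymptotic_line S q (line_through q v) \<and> cubic (xy q) (v $ 1) (v $ 2) = 0"
proof -
  have "(ddir (xy v) ^^ Suc (Suc (Suc 0))) F (xy q) = cubic (xy q) (v $ 1) (v $ 2)"
    using ddir3_eq_cubic[OF chart_in_U[OF q]] by (simp add: xy_def)
  then show ?thesis
    unfolding asymptotic_line_def
    using contact_Suc_iff[OF q v, of 1] by (simp add: numeral_2_eq_2 numeral_3_eq_3)
qed

lemma DERIV_along_curve:
  assumes H: "smooth_on U H" and c: "(c has_vector_derivative c') (at t)" and t: "xy (c t) \<in> U"
  shows "((\<lambda>t. H (xy (c t))) has_real_derivative c' $ 1 * D1 H (xy (c t)) + c' $ 2 * D2 H (xy (c t))) (at t)"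
proof -
  have "c t \<in> U3" using t by (simp add: U3_def)
  from has_derivative_compose[OF c[unfolded has_vector_derivative_def] has_derivative_comp_xy[OF H this]]
  have "((\<lambda>t. H (xy (c t))) has_derivative (\<lambda>s. ddir (s *\<^sub>R xy c') H (xy (c t)))) (at t)"
    by simp
  moreover have "ddir (s *\<^sub>R xy c') H (xy (c t)) =
      (c' $ 1 * D1 H (xy (c t)) + c' $ 2 * D2 H (xy (c t))) * s" for s
    unfolding linear_scale[OF linear_ddir[OF H t]] xy_def[of c'] ddir_pair[OF H t, of "c' $ 1" "c' $ 2"]
    by simp
  ultimately show ?thesis unfolding has_field_derivative_def by simp
qed

text \<open>The first two derivatives of the height are the combinations of those of the plane
  coordinates with coefficients \<open>D1 F p\<close> and \<open>D2 F p\<close>. The third one has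
  in addition the Hessian applied to the pair \<open>v\<close>, \<open>w\<close>. Subtracting this
  combination from the third column leaves the Hessian term as its only entry, so the determinant is
  a minor times it.\<close>

lemma frame_det_asymptotic_curve:
  assumes e: "e > 0" and c: "smooth_on {-e<..<e} c"
    and S: "\<And>t. t \<in> {-e<..<e} \<Longrightarrow> c t \<in> S \<and> c t \<in> W"
    and asym: "\<And>t. t \<in> {-e<..<e} \<Longrightarrow>
      quad (xy (c t)) (vector_derivative c (at t) $ 1) (vector_derivative c (at t) $ 2) = 0"
  defines "v \<equiv> vector_derivative c (at 0)" and "w \<equiv> nth_vector_derivative 2 c 0"
    and "p \<equiv> xy (c 0)"
  shows "frame_det c 0 = (v $ 1 * w $ 2 - v $ 2 * w $ 1) *
    (w $ 1 * (v $ 1 * D1 (D1 F) p + v $ 2 * D1 (D2 F) p) +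
     w $ 2 * (v $ 1 * D1 (D2 F) p + v $ 2 * D2 (D2 F) p))"
proof -
  define I where "I = {-e<..<e}"
  have I: "open I" "0 \<in> I" using e by (auto simp: I_def)
  define d where "d k = nth_vector_derivative k c" for k
  have dd: "(d k has_vector_derivative d (Suc k) t) (at t)" if "t \<in> I" for k t
    unfolding d_def I_def
    by (rule nth_vector_derivative_has_vector_derivative[OF _ c]) (use that in \<open>auto simp: I_def\<close>)
  have d0: "d 0 = c" by (simp add: d_def nth_vector_derivative_def)
  have d1: "d (Suc 0) t = vector_derivative c (at t)" for t by (simp add: d_def nth_vector_derivative_def)
  have comp: "((\<lambda>t. d k t $ i) has_real_derivative d (Suc k) t $ i) (at t)" if "t \<in> I" for k t i
    by (rule has_vector_derivative_vec_nth[OF dd[OF that]])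
  have U: "xy (c t) \<in> U" if "t \<in> I" for t
    using S chart_in_U that by (auto simp: I_def)
  have H: "((\<lambda>t. H (xy (c t))) has_real_derivative
      d 1 t $ 1 * D1 H (xy (c t)) + d 1 t $ 2 * D2 H (xy (c t))) (at t)"
    if "t \<in> I" "smooth_on U H" for H t
    using DERIV_along_curve[OF that(2), of c "d 1 t" t] U[OF that(1)] dd[OF that(1), of 0]
    by (simp add: d0)
  \<comment> \<open>Identities valid on the open interval may be differentiated; each relation for
    the height below is the derivative of the preceding one.\<close>
  have deq: "f' = g'" if "t \<in> I" "\<And>t. t \<in> I \<Longrightarrow> f t = g t"
      "(f has_real_derivative f') (at t)" "(g has_real_derivative g') (at t)" for f g :: "real \<Rightarrow> real" and f' g' t
    using DERIV_unique[OF that(3) has_field_derivative_transform_within_open[OF that(4) I(1) that(1)]] that(2)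
    by metis
  have z0: "d 0 t $ 3 = F (xy (c t))" if "t \<in> I" for t
    using S that mem_chart by (auto simp: I_def d0)
  have z1: "d 1 t $ 3 = d 1 t $ 1 * D1 F (xy (c t)) + d 1 t $ 2 * D2 F (xy (c t))" if "t \<in> I" for t
    using deq[OF that z0 comp[OF that] H[OF that smooth_F]] by simp
  \<comment> \<open>The extra term is the Hessian form on the velocity, zero for an asymptotic
    curve. It vanishes on the whole interval, so the result can be differentiated once more.\<close>
  have z2: "d 2 t $ 3 = d 2 t $ 1 * D1 F (xy (c t)) + d 2 t $ 2 * D2 F (xy (c t))" if "t \<in> I" for t
  proof -
    have "d (Suc 1) t $ 3 =
      (d (Suc 1) t $ 1 * D1 F (xy (c t)) +
        (d 1 t $ 1 * D1 (D1 F) (xy (c t)) + d 1 t $ 2 * D2 (D1 F) (xy (c t))) * d 1 t $ 1) +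
      (d (Suc 1) t $ 2 * D2 F (xy (c t)) +
        (d 1 t $ 1 * D1 (D2 F) (xy (c t)) + d 1 t $ 2 * D2 (D2 F) (xy (c t))) * d 1 t $ 2)"
      by (rule deq[OF that z1 comp[OF that]], assumption,
          intro DERIV_add DERIV_mult comp[OF that] H[OF that] smooth_D)
    moreover have "quad (xy (c t)) (d 1 t $ 1) (d 1 t $ 2) = 0"
      using asym that by (simp add: I_def d1)
    ultimately show ?thesis
      using D_commute(1)[OF U[OF that]]
      by (simp add: quad_def algebra_simps power2_eq_square numeral_2_eq_2)
  qed
  have z3: "d 3 0 $ 3 =
      (d 3 0 $ 1 * D1 F p + (v $ 1 * D1 (D1 F) p + v $ 2 * D2 (D1 F) p) * w $ 1) +
      (d 3 0 $ 2 * D2 F p + (v $ 1 * D1 (D2 F) p + v $ 2 * D2 (D2 F) p) * w $ 2)"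
  proof -
    have "d (Suc 2) 0 $ 3 =
      (d (Suc 2) 0 $ 1 * D1 F (xy (c 0)) +
        (d 1 0 $ 1 * D1 (D1 F) (xy (c 0)) + d 1 0 $ 2 * D2 (D1 F) (xy (c 0))) * d 2 0 $ 1) +
      (d (Suc 2) 0 $ 2 * D2 F (xy (c 0)) +
        (d 1 0 $ 1 * D1 (D2 F) (xy (c 0)) + d 1 0 $ 2 * D2 (D2 F) (xy (c 0))) * d 2 0 $ 2)"
      by (rule deq[OF I(2) z2 comp[OF I(2)]], assumption,
          intro DERIV_add DERIV_mult comp[OF I(2)] H[OF I(2)] smooth_D)
    then show ?thesis by (simp add: d1 v_def w_def p_def d_def[of 2])
  qed
  have "frame_det c 0 = det (vector [d 1 0, d 2 0, d 3 0] :: real^3^3)"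
    by (simp add: frame_det_def d_def)
  also have "\<dots> = (v $ 1 * w $ 2 - v $ 2 * w $ 1) *
    (w $ 1 * (v $ 1 * D1 (D1 F) p + v $ 2 * D1 (D2 F) p) +
     w $ 2 * (v $ 1 * D1 (D2 F) p + v $ 2 * D2 (D2 F) p))"
    using z1[OF I(2)] z2[OF I(2)] z3 D_commute(1)[OF U[OF I(2)]]
    by (simp add: det_3 d1 d_def[of 2] v_def[symmetric] w_def[symmetric] p_def[symmetric]) (simp add: algebra_simps)
  finally show ?thesis .
qed

end

section \<open>The two families of asymptotic directions near the origin\<close>

text \<open>On a diagonal the equation would give that twice the absolute value of \<open>B\<close>
  equals that of \<open>A + C\<close>; but the former exceeds 3/2 and the latter is below 1/2 times
  the absolute value of \<open>k\<close>. Hence the larger component tells the two families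
  apart.\<close>

lemma quadratic_directions:
  fixes A B C a b k :: real
  assumes "\<bar>A\<bar> < \<bar>k\<bar> / 4" "\<bar>C\<bar> < \<bar>k\<bar> / 4" "\<bar>B - k\<bar> < \<bar>k\<bar> / 4"
    and q: "a\<^sup>2 * A + 2 * a * b * B + b\<^sup>2 * C = 0" and ab: "a \<noteq> 0 \<or> b \<noteq> 0"
  shows "\<bar>b\<bar> < \<bar>a\<bar> \<or> \<bar>a\<bar> < \<bar>b\<bar>"
proof (rule ccontr)
  assume "\<not> ?thesis"
  then have e: "\<bar>a\<bar> = \<bar>b\<bar>" by simp
  then have "\<bar>a\<bar> * \<bar>b\<bar> = a\<^sup>2" by (metis power2_abs power2_eq_square)
  from e have sq: "a\<^sup>2 = b\<^sup>2" by (metis power2_abs)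
  have pos: "a\<^sup>2 > 0" using ab e by auto
  have "2 * (a * b) * B = - (a\<^sup>2 * (A + C))" using q sq by (simp add: algebra_simps)
  then have "2 * (\<bar>a\<bar> * \<bar>b\<bar>) * \<bar>B\<bar> = a\<^sup>2 * \<bar>A + C\<bar>"
    by (metis abs_minus_cancel abs_mult abs_numeral abs_power2)
  then have "a\<^sup>2 * (2 * \<bar>B\<bar>) = a\<^sup>2 * \<bar>A + C\<bar>"
    using \<open>\<bar>a\<bar> * \<bar>b\<bar> = a\<^sup>2\<close> by simp
  then have "2 * \<bar>B\<bar> = \<bar>A + C\<bar>" using pos by simp
  then show False using assms(1-3) by linarith
qed

lemma slope_sign:
  fixes B C m k :: real
  assumes "\<bar>C\<bar> < \<bar>k\<bar> / 4" "\<bar>B - k\<bar> < \<bar>k\<bar> / 4" "\<bar>m\<bar> \<le> 1"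
  shows "k * (B + C * m) > 0"
proof -
  have "\<bar>C * m\<bar> \<le> \<bar>C\<bar>" using assms(3) by (simp add: abs_mult mult_left_le)
  then have "\<bar>C * m\<bar> < \<bar>k\<bar> / 4" using assms(1) by simp
  then have "(k > 0 \<and> B + C * m > 0) \<or> (k < 0 \<and> B + C * m < 0)"
    using assms(2) by argo
  then show ?thesis by (simp add: zero_less_mult_iff)
qed

text \<open>The Hessian applied to \<open>(a, b)\<close> is a linear form that kills
  \<open>(a, b)\<close>, hence a multiple of the form \<open>a * v - b * u\<close> in
  \<open>(u, v)\<close>, with factor \<open>B + C * (b / a)\<close>. The product is thus a square
  times a quantity of the sign of \<open>k\<close>. The other family is the same statement with the
  coordinates exchanged.\<close>

lemma frame_sign:
  fixes A B C a b u v k :: real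
  assumes "\<bar>C\<bar> < \<bar>k\<bar> / 4" "\<bar>B - k\<bar> < \<bar>k\<bar> / 4"
    and q: "a\<^sup>2 * A + 2 * a * b * B + b\<^sup>2 * C = 0" and ab: "\<bar>b\<bar> < \<bar>a\<bar>"
  shows "k * ((a * v - b * u) * (u * (a * A + b * B) + v * (a * B + b * C))) \<ge> 0"
proof -
  have a: "a \<noteq> 0" using ab by auto
  have "a * (a * A + b * B) = - b * (a * B + b * C)"
    using q by (simp add: algebra_simps power2_eq_square)
  then have "a * (u * (a * A + b * B) + v * (a * B + b * C)) = (a * v - b * u) * (a * B + b * C)"
    by algebra
  then have "u * (a * A + b * B) + v * (a * B + b * C) = (a * v - b * u) * (B + C * (b / a))"
    using a by (simp add: field_simps)
  then have "k * ((a * v - b * u) * (u * (a * A + b * B) + v * (a * B + b * C))) =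
      (a * v - b * u)\<^sup>2 * (k * (B + C * (b / a)))"
    by (simp only: power2_eq_square mult_ac)
  moreover have "\<bar>b / a\<bar> \<le> 1" using ab by simp
  ultimately show ?thesis
    using slope_sign[OF assms(1,2), of "b / a"] by (metis less_imp_le mult_nonneg_nonneg zero_le_power2)
qed

text \<open>Differentiates at \<open>0\<close> the pair of equations satisfied by an asymptotic slope \<open>m\<close> along a
  flecnodal curve, without knowing that \<open>m\<close> is differentiable: \<open>m = - A / (2 * B + C * m)\<close>.\<close>

lemma tangent_equation:
  fixes A B C P Q R T :: "real \<Rightarrow> real"
  assumes A: "(A has_real_derivative A') (at 0)" "A 0 = 0"
    and P: "(P has_real_derivative P') (at 0)" "P 0 = 0"
    and cont: "isCont B 0" "isCont C 0" "isCont Q 0" "isCont R 0" "isCont T 0"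
    and B: "B 0 = k" "k \<noteq> 0" and C: "C 0 = 0"
    and eqs: "eventually (\<lambda>t. \<exists>m. \<bar>m\<bar> \<le> 1 \<and> A t + 2 * m * B t + m\<^sup>2 * C t = 0 \<and>
      P t + 3 * m * Q t + 3 * m\<^sup>2 * R t + m ^ 3 * T t = 0) (at 0)"
  shows "2 * k * P' = 3 * Q 0 * A'"
proof -
  define E where "E t m \<longleftrightarrow> \<bar>m\<bar> \<le> 1 \<and> A t + 2 * m * B t + m\<^sup>2 * C t = 0 \<and>
      P t + 3 * m * Q t + 3 * m\<^sup>2 * R t + m ^ 3 * T t = 0" for t m
  \<comment> \<open>A root is picked separately for each \<open>t\<close>, without any continuity;
    boundedness by 1 is enough to pass to the limit in the denominator.\<close>
  define m where "m t = (SOME m. E t m)" for t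
  have ev: "eventually (\<lambda>t. E t (m t)) (at 0)"
    using eqs unfolding E_def[symmetric] by eventually_elim (simp add: m_def someI_ex)
  have lim: "(f \<longlongrightarrow> f 0) (at 0)" if "isCont f 0" for f :: "real \<Rightarrow> real"
    using that by (simp add: isCont_def)
  have bnd: "Bfun m (at 0)"
    by (rule BfunI[of _ 1]) (use ev in eventually_elim, simp add: E_def)
  have Cm: "((\<lambda>t. C t * m t) \<longlongrightarrow> 0) (at 0)"
  proof (rule Lim_null_comparison)
    show "eventually (\<lambda>t. norm (C t * m t) \<le> \<bar>C t\<bar>) (at 0)"
      using ev by eventually_elim (simp add: E_def abs_mult mult_left_le)
    show "((\<lambda>t. \<bar>C t\<bar>) \<longlongrightarrow> 0) (at 0)" using lim[OF cont(2)] C by (simp add: tendsto_rabs_zero)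
  qed
  have den: "((\<lambda>t. 2 * B t + C t * m t) \<longlongrightarrow> 2 * k) (at 0)"
    using tendsto_add[OF tendsto_mult_left[OF lim[OF cont(1)], of 2] Cm] B by simp
  have ne: "eventually (\<lambda>t. 2 * B t + C t * m t \<noteq> 0) (at 0)"
    using tendsto_imp_eventually_ne[OF den] B by simp
  have At: "((\<lambda>t. A t / t) \<longlongrightarrow> A') (at 0)" and Pt: "((\<lambda>t. P t / t) \<longlongrightarrow> P') (at 0)"
    using A P by (simp_all add: has_field_derivative_iff)
  have nz: "eventually (\<lambda>t::real. t \<noteq> 0) (at 0)" by (simp add: eventually_at_filter)
  \<comment> \<open>The limit plays the role of the derivative of the slope at 0, and it implies
    that \<open>m t\<close> tends to 0.\<close>
  have mt: "((\<lambda>t. m t / t) \<longlongrightarrow> - A' / (2 * k)) (at 0)"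
  proof (rule Lim_transform_eventually)
    show "((\<lambda>t. - (A t / t) / (2 * B t + C t * m t)) \<longlongrightarrow> - A' / (2 * k)) (at 0)"
      by (intro tendsto_divide tendsto_minus At den) (use B in simp)
    show "eventually (\<lambda>t. - (A t / t) / (2 * B t + C t * m t) = m t / t) (at 0)"
      using ev ne nz
    proof eventually_elim
      case (elim t)
      have "A t = - m t * (2 * B t + C t * m t)"
        using elim(1) by (simp add: E_def algebra_simps power2_eq_square)
      then have "- (A t / t) = m t / t * (2 * B t + C t * m t)" by simp
      then show ?case using elim(2) by simp
    qed
  qed
  have m0: "(m \<longlongrightarrow> 0) (at 0)"
  proof (rule Lim_transform_eventually)
    show "((\<lambda>t. m t / t * t) \<longlongrightarrow> 0) (at 0)"
      using tendsto_mult[OF mt tendsto_ident_at] by simp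
    show "eventually (\<lambda>t. m t / t * t = m t) (at 0)" using nz by eventually_elim simp
  qed
  \<comment> \<open>The cubic equation divided by \<open>t\<close>. The terms with \<open>R\<close>
    and \<open>T\<close> keep a factor \<open>m t\<close> and disappear in the limit.\<close>
  have "((\<lambda>t. P t / t + 3 * (m t / t) * Q t + 3 * (m t / t) * (m t * R t) + (m t / t) * (m t * m t * T t))
      \<longlongrightarrow> P' + 3 * (- A' / (2 * k)) * Q 0 + 3 * (- A' / (2 * k)) * (0 * R 0)
        + (- A' / (2 * k)) * (0 * 0 * T 0)) (at 0)"
    by (intro tendsto_intros Pt mt m0 lim cont)
  moreover have "eventually (\<lambda>t. P t / t + 3 * (m t / t) * Q t + 3 * (m t / t) * (m t * R t)
      + (m t / t) * (m t * m t * T t) = 0) (at 0)"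
    using ev nz
  proof eventually_elim
    case (elim t)
    have "P t / t + 3 * (m t / t) * Q t + 3 * (m t / t) * (m t * R t) + (m t / t) * (m t * m t * T t)
        = (P t + 3 * m t * Q t + 3 * (m t)\<^sup>2 * R t + m t ^ 3 * T t) / t"
      using elim(2) by (simp add: field_simps power2_eq_square power3_eq_cube)
    then show ?case using elim(1) by (simp add: E_def)
  qed
  ultimately have "((\<lambda>t::real. 0::real) \<longlongrightarrow> P' + 3 * (- A' / (2 * k)) * Q 0 + 3 * (- A' / (2 * k)) * (0 * R 0)
        + (- A' / (2 * k)) * (0 * 0 * T 0)) (at 0)"
    by (rule Lim_transform_eventually)
  then have "P' + 3 * (- A' / (2 * k)) * Q 0 = 0"
    by (simp add: tendsto_const_iff)
  then show ?thesis using B by (simp add: field_simps)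
qed

section \<open>Monge form at the origin with the axes as asymptotic lines\<close>

locale monge_chart = graph_chart +
  assumes origin_U: "(0, 0) \<in> U" and origin_W: "0 \<in> W" and F_0: "F (0, 0) = 0"
    and dF_0: "(F has_derivative (\<lambda>_. 0)) (at (0, 0))"
    and axes: "{L. asymptotic_line S 0 L} = {line_through 0 (axis 1 1), line_through 0 (axis 2 1)}"
begin

definition f11 :: real where "f11 = D1 (D2 F) (0, 0)"

lemma xy_0 [simp]: "xy 0 = (0, 0)" by (simp add: xy_def)

lemma origin_S: "0 \<in> S"
  using mem_chart[OF origin_W] origin_U F_0 by simp

lemma ddir_F_0: "ddir v F (0, 0) = 0"
  using ddir_eqI[OF dF_0] .

lemma asymptotic_0_iff:
  "v \<noteq> 0 \<Longrightarrow> asymptotic_line S 0 (line_through 0 v) \<longleftrightarrow> v $ 3 = 0 \<and> quad (0, 0) (v $ 1) (v $ 2) = 0"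
  using asymptotic_line_iff[OF origin_S origin_W] by (simp add: ddir_F_0)

lemma axis_simps: "(axis 1 1 :: real^3) $ 1 = 1" "(axis 1 1 :: real^3) $ 2 = 0" "(axis 1 1 :: real^3) $ 3 = 0"
  "(axis 2 1 :: real^3) $ 1 = 0" "(axis 2 1 :: real^3) $ 2 = 1" "(axis 2 1 :: real^3) $ 3 = 0"
  "axis 1 1 \<noteq> (0 :: real^3)" "axis 2 1 \<noteq> (0 :: real^3)"
  by (auto simp: axis_def vec_eq_iff)

lemma axes_asymptotic:
  "asymptotic_line S 0 (line_through 0 (axis 1 1))" "asymptotic_line S 0 (line_through 0 (axis 2 1))"
  using axes by blast+

lemma f20: "D1 (D1 F) (0, 0) = 0" and f02: "D2 (D2 F) (0, 0) = 0"
  using axes_asymptotic asymptotic_0_iff axis_simps by (auto simp: quad_def)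

text \<open>Otherwise the Hessian at the origin would be zero, and the diagonal would be a third
  asymptotic line.\<close>

lemma f11_nonzero: "f11 \<noteq> 0"
proof
  assume "f11 = 0"
  define v :: "real^3" where "v = axis 1 1 + axis 2 1"
  have v: "v $ 1 = 1" "v $ 2 = 1" "v $ 3 = 0" by (simp_all add: v_def axis_simps)
  then have "v \<noteq> 0" by auto
  then have "asymptotic_line S 0 (line_through 0 v)"
    using \<open>f11 = 0\<close> by (simp add: asymptotic_0_iff quad_def v f20 f02 f11_def[symmetric])
  then have "line_through 0 v = line_through 0 (axis 1 1) \<or> line_through 0 v = line_through 0 (axis 2 1)"
    using axes by blast
  then obtain c where "v = c *\<^sub>R axis 1 1 \<or> v = c *\<^sub>R axis 2 1"
    using line_through_eqD[OF _ \<open>v \<noteq> 0\<close>] by metis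
  then show False using v by (auto simp: axis_simps)
qed

text \<open>The open set on which the Hessian satisfies the bounds of
  \<open>quadratic_directions\<close> and \<open>frame_sign\<close> with \<open>k = f11\<close>. At
  the origin its diagonal entries are 0 and its mixed entry is \<open>f11\<close>.\<close>

definition near :: "(real^3) set" where
  "near = {q \<in> W \<inter> U3. \<bar>D1 (D1 F) (xy q)\<bar> < \<bar>f11\<bar> / 4 \<and> \<bar>D2 (D2 F) (xy q)\<bar> < \<bar>f11\<bar> / 4 \<and>
     \<bar>D1 (D2 F) (xy q) - f11\<bar> < \<bar>f11\<bar> / 4}"

lemma continuous_on_D: "smooth_on U H \<Longrightarrow> continuous_on (W \<inter> U3) (\<lambda>q. H (xy q))"
  by (rule continuous_on_compose2[of U H])
    (auto intro!: continuous_at_imp_continuous_on smooth_on_isCont isCont_xy simp: U3_def)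

lemma open_near: "open near"
proof -
  have "open ((W \<inter> U3) \<inter> (\<lambda>q. \<bar>D1 (D1 F) (xy q)\<bar>) -` {..<\<bar>f11\<bar> / 4} \<inter>
      ((W \<inter> U3) \<inter> (\<lambda>q. \<bar>D2 (D2 F) (xy q)\<bar>) -` {..<\<bar>f11\<bar> / 4}) \<inter>
      ((W \<inter> U3) \<inter> (\<lambda>q. \<bar>D1 (D2 F) (xy q) - f11\<bar>) -` {..<\<bar>f11\<bar> / 4}))"
    by (intro open_Int continuous_open_preimage continuous_intros continuous_on_D smooth_D
        open_W open_U3 open_lessThan)
  also have "\<dots> = near" by (auto simp: near_def)
  finally show ?thesis .
qed

lemma origin_near: "0 \<in> near"
  using origin_W origin_U f11_nonzero f20 f02 by (simp add: near_def U3_def f11_def)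

lemma nearD: assumes "q \<in> near" shows "q \<in> W" "\<bar>D1 (D1 F) (xy q)\<bar> < \<bar>f11\<bar> / 4"
  "\<bar>D2 (D2 F) (xy q)\<bar> < \<bar>f11\<bar> / 4" "\<bar>D1 (D2 F) (xy q) - f11\<bar> < \<bar>f11\<bar> / 4"
  using assms by (auto simp: near_def)

lemma asymptotic_direction_cases:
  assumes q: "q \<in> S" "q \<in> near" and v: "v \<noteq> 0" and a: "asymptotic_line S q (line_through q v)"
  shows "\<bar>v $ 2\<bar> < \<bar>v $ 1\<bar> \<or> \<bar>v $ 1\<bar> < \<bar>v $ 2\<bar>"
proof -
  have qd: "v $ 3 = ddir (xy v) F (xy q)" "quad (xy q) (v $ 1) (v $ 2) = 0"
    using asymptotic_line_iff[OF q(1) nearD(1)[OF q(2)] v] a by auto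
  \<comment> \<open>A tangent vector with zero projection to the plane has zero height component as
    well.\<close>
  have "v $ 1 \<noteq> 0 \<or> v $ 2 \<noteq> 0"
  proof (rule ccontr)
    assume z: "\<not> ?thesis"
    then have "v $ 3 = 0"
      using qd(1) linear_0[OF linear_ddir[OF smooth_F chart_in_U[OF q(1) nearD(1)[OF q(2)]]]]
      by (simp add: xy_def zero_prod_def)
    then have "v = 0" using z by (simp add: vec_eq_iff forall_3)
    then show False using v by simp
  qed
  then show ?thesis
    using quadratic_directions[OF nearD(2-4)[OF q(2)] qd(2)[unfolded quad_def]] by blast
qed

lemma frame_det_sign:
  assumes V: "asymptotic_field S (S \<inter> N) V" and c: "integral_curve (S \<inter> N) V e c" and c0: "c 0 \<in> near"
  shows "\<bar>V (c 0) $ 2\<bar> < \<bar>V (c 0) $ 1\<bar> \<Longrightarrow> f11 * frame_det c 0 \<ge> 0"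
    and "\<bar>V (c 0) $ 1\<bar> < \<bar>V (c 0) $ 2\<bar> \<Longrightarrow> f11 * frame_det c 0 \<le> 0"
proof -
  have e: "e > 0" and sm: "smooth_on {-e<..<e} c"
    and ic: "\<And>t. t \<in> {-e<..<e} \<Longrightarrow> c t \<in> S \<inter> N \<and> vector_derivative c (at t) \<noteq> 0 \<and>
        vector_derivative c (at t) \<in> span {V (c t)}"
    using c unfolding integral_curve_def by auto
  have "isCont c 0" using smooth_on_isCont[OF sm] e by simp
  then have "eventually (\<lambda>t. c t \<in> near) (nhds 0)"
    using topological_tendstoD[OF _ open_near c0] by (simp add: isCont_def tendsto_at_iff_tendsto_nhds)
  then obtain d where d: "d > 0" "\<And>t. \<bar>t\<bar> < d \<Longrightarrow> c t \<in> near"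
    unfolding eventually_nhds_metric dist_real_def by auto
  \<comment> \<open>The integral curve lives on \<open>S \<inter> N\<close> and may leave
    \<open>near\<close>; the frame at 0 only depends on a short piece of it.\<close>
  define r where "r = min e d"
  have r: "r > 0" using e d by (simp add: r_def)
  have sub: "t \<in> {-e<..<e}" "c t \<in> near" if "t \<in> {-r<..<r}" for t
    using that d(2)[of t] by (auto simp: r_def)
  have par: "\<exists>a. a \<noteq> 0 \<and> vector_derivative c (at t) = a *\<^sub>R V (c t)" if "t \<in> {-r<..<r}" for t
    using ic[OF sub(1)[OF that]] by (auto simp: span_singleton)
  have quad: "quad (xy (c t)) (vector_derivative c (at t) $ 1) (vector_derivative c (at t) $ 2) = 0"
    if t: "t \<in> {-r<..<r}" for t
  proof -
    obtain a where a: "a \<noteq> 0" "vector_derivative c (at t) = a *\<^sub>R V (c t)" using par[OF t] by blast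
    have ct: "c t \<in> S \<inter> N" using ic sub(1)[OF t] by blast
    then have "asymptotic_line S (c t) (line_through (c t) (vector_derivative c (at t)))"
      using V unfolding a(2) line_through_scale[OF a(1)] asymptotic_field_def by blast
    then show ?thesis
      using asymptotic_line_iff[of "c t" "vector_derivative c (at t)"] ct ic[OF sub(1)[OF t]]
        nearD(1)[OF sub(2)[OF t]] by blast
  qed
  define v where "v = vector_derivative c (at 0)"
  define w where "w = nth_vector_derivative 2 c 0"
  define p where "p = xy (c 0)"
  have fd: "frame_det c 0 = (v $ 1 * w $ 2 - v $ 2 * w $ 1) *
    (w $ 1 * (v $ 1 * D1 (D1 F) p + v $ 2 * D1 (D2 F) p) +
     w $ 2 * (v $ 1 * D1 (D2 F) p + v $ 2 * D2 (D2 F) p))"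
    unfolding v_def w_def p_def
  proof (rule frame_det_asymptotic_curve[OF r _ _ quad])
    show "smooth_on {-r<..<r} c" by (rule smooth_on_subset[OF sm]) (auto simp: r_def)
    show "c t \<in> S \<and> c t \<in> W" if "t \<in> {-r<..<r}" for t
      using ic[OF sub(1)[OF that]] nearD(1)[OF sub(2)[OF that]] by blast
  qed
  have q0: "(v $ 1)\<^sup>2 * D1 (D1 F) p + 2 * v $ 1 * v $ 2 * D1 (D2 F) p + (v $ 2)\<^sup>2 * D2 (D2 F) p = 0"
    using quad[of 0] r by (simp add: quad_def v_def p_def)
  obtain a where a: "a \<noteq> 0" "v = a *\<^sub>R V (c 0)" using par[of 0] r by (auto simp: v_def)
  note n = nearD(2-4)[OF c0, folded p_def]
  {
    assume "\<bar>V (c 0) $ 2\<bar> < \<bar>V (c 0) $ 1\<bar>"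
    then have "\<bar>v $ 2\<bar> < \<bar>v $ 1\<bar>" using a by (simp add: abs_mult)
    from frame_sign[OF n(2,3) q0 this, of "w $ 2" "w $ 1"]
    show "f11 * frame_det c 0 \<ge> 0" by (simp add: fd)
  next
    assume "\<bar>V (c 0) $ 1\<bar> < \<bar>V (c 0) $ 2\<bar>"
    then have lt: "\<bar>v $ 1\<bar> < \<bar>v $ 2\<bar>" using a by (simp add: abs_mult)
    \<comment> \<open>Exchanging the coordinates preserves the Hessian factor of the determinant and
      reverses the sign of the minor, so the second family has the opposite sign.\<close>
    have "(v $ 2)\<^sup>2 * D2 (D2 F) p + 2 * v $ 2 * v $ 1 * D1 (D2 F) p + (v $ 1)\<^sup>2 * D1 (D1 F) p = 0"
      using q0 by (simp add: algebra_simps)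
    from frame_sign[OF n(1,3) this lt, of "w $ 1" "w $ 2"]
    show "f11 * frame_det c 0 \<le> 0" by (simp add: fd algebra_simps)
  }
qed

text \<open>The closure condition provides integral curves with frames of strict sign
  \<open>s\<close> starting arbitrarily close to \<open>q\<close>. By continuity of \<open>V\<close>
  their directions belong to the family of \<open>V q\<close>, and \<open>frame_det_sign\<close>
  rules out the wrong family.\<close>

lemma line_of_sign_direction:
  assumes q: "q \<in> S" "q \<in> near" and L: "asymptotic_line_of_sign s S q L"
  obtains v where "v \<noteq> 0" "L = line_through q v" "asymptotic_line S q L"
    "s * f11 > 0 \<Longrightarrow> \<bar>v $ 2\<bar> < \<bar>v $ 1\<bar>" "s * f11 < 0 \<Longrightarrow> \<bar>v $ 1\<bar> < \<bar>v $ 2\<bar>"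
proof -
  obtain N V where N: "open N" "q \<in> N" and V: "asymptotic_field S (S \<inter> N) V"
    and Lq: "L = line_through q (V q)"
    and cl: "q \<in> closure {c 0 | c e. integral_curve (S \<inter> N) V e c \<and> s * frame_det c 0 > 0}"
    using L unfolding asymptotic_line_of_sign_def by blast
  have qN: "q \<in> S \<inter> N" using q N by blast
  have Vq: "V q \<noteq> 0" "asymptotic_line S q (line_through q (V q))"
    using V qN unfolding asymptotic_field_def by auto
  have contV: "continuous_on (S \<inter> N) V" using V unfolding asymptotic_field_def by blast
  have key: "\<exists>c e. integral_curve (S \<inter> N) V e c \<and> s * frame_det c 0 > 0 \<and> c 0 \<in> near \<and>
      \<bar>V (c 0) $ i\<bar> < \<bar>V (c 0) $ j\<bar>" if lt: "\<bar>V q $ i\<bar> < \<bar>V q $ j\<bar>" for i j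
  proof -
    have "continuous_on (S \<inter> N) (\<lambda>x. \<bar>V x $ j\<bar> - \<bar>V x $ i\<bar>)"
      by (intro continuous_intros contV)
    then have "((\<lambda>x. \<bar>V x $ j\<bar> - \<bar>V x $ i\<bar>) \<longlongrightarrow> \<bar>V q $ j\<bar> - \<bar>V q $ i\<bar>) (at q within S \<inter> N)"
      using qN by (auto simp: continuous_on_def)
    then have "eventually (\<lambda>x. 0 < \<bar>V x $ j\<bar> - \<bar>V x $ i\<bar>) (at q within S \<inter> N)"
      by (rule order_tendstoD) (use lt in simp)
    then obtain Q where Q: "open Q" "q \<in> Q"
      "\<And>x. x \<in> Q \<Longrightarrow> x \<in> S \<inter> N \<Longrightarrow> x \<noteq> q \<Longrightarrow> \<bar>V x $ i\<bar> < \<bar>V x $ j\<bar>"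
      unfolding eventually_at_topological by auto
    have "open (Q \<inter> near)" "q \<in> Q \<inter> near" using Q q open_near by auto
    then obtain c e where c: "integral_curve (S \<inter> N) V e c" "s * frame_det c 0 > 0" "c 0 \<in> Q \<inter> near"
      using cl unfolding closure_iff_nhds_not_empty by blast
    have "c 0 \<in> S \<inter> N" using c(1) unfolding integral_curve_def by auto
    \<comment> \<open>\<open>Q\<close> comes from a punctured neighbourhood; if the curve starts at
      \<open>q\<close> itself, the inequality is the assumption \<open>lt\<close>.\<close>
    then have "\<bar>V (c 0) $ i\<bar> < \<bar>V (c 0) $ j\<bar>" using Q(3)[of "c 0"] c(3) lt by (cases "c 0 = q") auto
    then show ?thesis using c by blast
  qed
  have sg: "s * f11 > 0 \<Longrightarrow> s * x > 0 \<Longrightarrow> f11 * x \<le> 0 \<Longrightarrow> False"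
    "s * f11 < 0 \<Longrightarrow> s * x > 0 \<Longrightarrow> f11 * x \<ge> 0 \<Longrightarrow> False" for x
    by (auto simp: zero_less_mult_iff mult_less_0_iff zero_le_mult_iff mult_le_0_iff)
  show thesis
  proof (rule that[OF Vq(1) Lq])
    show "asymptotic_line S q L" using Vq(2) Lq by simp
    assume s: "s * f11 > 0"
    have "\<not> \<bar>V q $ 1\<bar> < \<bar>V q $ 2\<bar>"
      using key[of 1 2] frame_det_sign(2)[OF V] sg(1)[OF s] by blast
    then show "\<bar>V q $ 2\<bar> < \<bar>V q $ 1\<bar>" using asymptotic_direction_cases[OF q Vq] by blast
  next
    assume s: "s * f11 < 0"
    have "\<not> \<bar>V q $ 2\<bar> < \<bar>V q $ 1\<bar>"
      using key[of 2 1] frame_det_sign(1)[OF V] sg(2)[OF s] by blast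
    then show "\<bar>V q $ 1\<bar> < \<bar>V q $ 2\<bar>" using asymptotic_direction_cases[OF q Vq] by blast
  qed
qed

end

section \<open>Cross-ratio and tangent lines of the flecnodal curves\<close>

text \<open>The area form of the tangent plane at the origin, read off from the first two
  components.\<close>

definition bracket :: "real^3 \<Rightarrow> real^3 \<Rightarrow> real" where
  "bracket v w = v $ 1 * w $ 2 - v $ 2 * w $ 1"

lemma bracket_pencil:
  "bracket (u + x *\<^sub>R w) (u + y *\<^sub>R w) = (y - x) * bracket u w"
  by (simp add: bracket_def algebra_simps)

lemma bracket_scaleR: "bracket (a *\<^sub>R v) (b *\<^sub>R w) = a * b * bracket v w"
  by (simp add: bracket_def algebra_simps)

text \<open>Differences of parameters are brackets of the direction vectors up to scale. Each of the
  four vectors occurs once in the numerator and once in the denominator, so the scale factors and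
  the powers of \<open>bracket u w\<close> cancel.\<close>

lemma cross_ratio_of_parameters:
  assumes "u \<noteq> w" "independent {u, w}"
    and L: "line_through 0 d1 = line_through 0 (u + x1 *\<^sub>R w)"
      "line_through 0 d2 = line_through 0 (u + x2 *\<^sub>R w)"
      "line_through 0 d3 = line_through 0 (u + x3 *\<^sub>R w)"
      "line_through 0 d4 = line_through 0 (u + x4 *\<^sub>R w)"
    and nz: "bracket d2 d4 \<noteq> 0"
  shows "((x1 - x3) * (x2 - x4)) / ((x1 - x4) * (x2 - x3)) =
    (bracket d1 d3 * bracket d2 d4) / (bracket d1 d4 * bracket d2 d3)"
proof -
  have u: "u \<notin> span {w}" using assms(1,2) by (simp add: independent_insert)
  have "\<exists>k. k \<noteq> 0 \<and> u + x *\<^sub>R w = k *\<^sub>R d" if "line_through 0 d = line_through 0 (u + x *\<^sub>R w)" for x d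
  proof -
    have "u + x *\<^sub>R w \<noteq> 0"
      using u span_mul[OF span_base[of w "{w}"], of "- x"] by (auto simp: eq_neg_iff_add_eq_0[symmetric])
    from line_through_eqD[OF that[symmetric] this] show ?thesis by metis
  qed
  from this[OF L(1)] this[OF L(2)] this[OF L(3)] this[OF L(4)]
  obtain k1 k2 k3 k4 where k: "k1 \<noteq> 0" "k2 \<noteq> 0" "k3 \<noteq> 0" "k4 \<noteq> 0"
    and e: "u + x1 *\<^sub>R w = k1 *\<^sub>R d1" "u + x2 *\<^sub>R w = k2 *\<^sub>R d2" "u + x3 *\<^sub>R w = k3 *\<^sub>R d3"
      "u + x4 *\<^sub>R w = k4 *\<^sub>R d4" by metis
  define D where "D = bracket u w"
  define K where "K = k1 * k2 * k3 * k4"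
  have b: "(x3 - x1) * D = k1 * k3 * bracket d1 d3" "(x4 - x2) * D = k2 * k4 * bracket d2 d4"
    "(x4 - x1) * D = k1 * k4 * bracket d1 d4" "(x3 - x2) * D = k2 * k3 * bracket d2 d3"
    unfolding D_def bracket_pencil[symmetric] e by (simp_all only: bracket_scaleR)
  have D: "D \<noteq> 0" using b(2) nz k by auto
  have "(x1 - x3) * (x2 - x4) * D\<^sup>2 = ((x3 - x1) * D) * ((x4 - x2) * D)"
    by (simp add: algebra_simps power2_eq_square)
  also have "\<dots> = bracket d1 d3 * bracket d2 d4 * K" unfolding b K_def by simp
  finally have num: "(x1 - x3) * (x2 - x4) * D\<^sup>2 = bracket d1 d3 * bracket d2 d4 * K" .
  have "(x1 - x4) * (x2 - x3) * D\<^sup>2 = ((x4 - x1) * D) * ((x3 - x2) * D)"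
    by (simp add: algebra_simps power2_eq_square)
  also have "\<dots> = bracket d1 d4 * bracket d2 d3 * K" unfolding b K_def by simp
  finally have den: "(x1 - x4) * (x2 - x3) * D\<^sup>2 = bracket d1 d4 * bracket d2 d3 * K" .
  have "D\<^sup>2 \<noteq> 0" "K \<noteq> 0" using D k by (auto simp: K_def)
  then show ?thesis using num den
    by (metis mult_divide_mult_cancel_right)
qed

lemma cross_ratio_eq_bracket:
  fixes d1 d2 d3 d4 :: "real^3"
  assumes plane: "d1 $ 3 = 0" "d2 $ 3 = 0" "d3 $ 3 = 0" "d4 $ 3 = 0"
    and d: "d1 \<noteq> 0" "d2 \<noteq> 0" "d3 \<noteq> 0" "d4 \<noteq> 0" and nz: "bracket d2 d4 \<noteq> 0"
  shows "cross_ratio 0 (line_through 0 d1) (line_through 0 d2) (line_through 0 d3) (line_through 0 d4) =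
    (bracket d1 d3 * bracket d2 d4) / (bracket d1 d4 * bracket d2 d3)"
  unfolding cross_ratio_def
proof (rule the_equality)
  define R where "R = {d1, d2, d3, d4}"
  have "finite ((\<lambda>v. v $ 2 / v $ 1) ` R)" by (simp add: R_def)
  then obtain \<mu> where \<mu>: "\<mu> \<notin> (\<lambda>v. v $ 2 / v $ 1) ` R" "\<mu> \<noteq> 0"
    using ex_new_if_finite[OF infinite_UNIV_char_0, of "insert 0 ((\<lambda>v. v $ 2 / v $ 1) ` R)"] by auto
  \<comment> \<open>\<open>w\<close> is the direction at infinite parameter; by the choice of
    \<open>\<mu>\<close> it spans none of the four lines. A line along the second axis, whose slope
    reads 0 through division by zero, is the line of \<open>u\<close>, at parameter 0.\<close>
  define u w :: "real^3" where "u = axis 2 1" and "w = axis 1 1 + \<mu> *\<^sub>R axis 2 1"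
  have uw: "u $ 1 = 0" "u $ 2 = 1" "u $ 3 = 0" "w $ 1 = 1" "w $ 2 = \<mu>" "w $ 3 = 0"
    by (auto simp: u_def w_def axis_def)
  have "w \<noteq> 0" "u \<noteq> w" using uw by auto
  have "u \<notin> span {w}"
  proof
    assume "u \<in> span {w}"
    then obtain r where "u = r *\<^sub>R w" by (auto simp: span_singleton)
    then have "u $ 1 = r * w $ 1" "u $ 2 = r * w $ 2" by auto
    then show False using uw by simp
  qed
  then have ind: "independent {u, w}" using \<open>w \<noteq> 0\<close> \<open>u \<noteq> w\<close> by (simp add: independent_insert)
  have par: "\<exists>x. line_through 0 v = line_through 0 (u + x *\<^sub>R w)" if v: "v \<in> R" for v
  proof -
    have v3: "v $ 3 = 0" "v \<noteq> 0" using v plane d by (auto simp: R_def)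
    define l where "l = v $ 2 - \<mu> * v $ 1"
    have "l \<noteq> 0"
    proof
      assume "l = 0"
      then have "v $ 2 = \<mu> * v $ 1" by (simp add: l_def)
      moreover from this have "v $ 1 \<noteq> 0" using v3 by (auto simp: vec_eq_iff forall_3)
      ultimately have "\<mu> = v $ 2 / v $ 1" by simp
      then show False using \<mu>(1) v by blast
    qed
    \<comment> \<open>In the basis \<open>u\<close>, \<open>w\<close> the vector \<open>v\<close>
      has coordinates \<open>l\<close> and \<open>v $ 1\<close>.\<close>
    have "u + (v $ 1 / l) *\<^sub>R w = (1 / l) *\<^sub>R v"
      using \<open>l \<noteq> 0\<close> v3 uw by (simp add: vec_eq_iff forall_3 l_def field_simps)
    then have "line_through 0 (u + (v $ 1 / l) *\<^sub>R w) = line_through 0 v"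
      using line_through_scale[of "1 / l" 0 v] \<open>l \<noteq> 0\<close> by simp
    then show ?thesis by metis
  qed
  obtain x1 x2 x3 x4 where x: "line_through 0 d1 = line_through 0 (u + x1 *\<^sub>R w)"
      "line_through 0 d2 = line_through 0 (u + x2 *\<^sub>R w)"
      "line_through 0 d3 = line_through 0 (u + x3 *\<^sub>R w)"
      "line_through 0 d4 = line_through 0 (u + x4 *\<^sub>R w)"
    using par[of d1] par[of d2] par[of d3] par[of d4] unfolding R_def by blast
  show "\<exists>u w x1 x2 x3 x4. u \<noteq> w \<and> independent {u, w} \<and>
     line_through 0 d1 = line_through 0 (u + x1 *\<^sub>R w) \<and> line_through 0 d2 = line_through 0 (u + x2 *\<^sub>R w) \<and>
     line_through 0 d3 = line_through 0 (u + x3 *\<^sub>R w) \<and> line_through 0 d4 = line_through 0 (u + x4 *\<^sub>R w) \<and>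
     (bracket d1 d3 * bracket d2 d4) / (bracket d1 d4 * bracket d2 d3) =
       ((x1 - x3) * (x2 - x4)) / ((x1 - x4) * (x2 - x3))"
    using cross_ratio_of_parameters[OF \<open>u \<noteq> w\<close> ind x nz] x \<open>u \<noteq> w\<close> ind by metis
next
  fix r
  assume "\<exists>u w x1 x2 x3 x4. u \<noteq> w \<and> independent {u, w} \<and>
     line_through 0 d1 = line_through 0 (u + x1 *\<^sub>R w) \<and> line_through 0 d2 = line_through 0 (u + x2 *\<^sub>R w) \<and>
     line_through 0 d3 = line_through 0 (u + x3 *\<^sub>R w) \<and> line_through 0 d4 = line_through 0 (u + x4 *\<^sub>R w) \<and>
     r = ((x1 - x3) * (x2 - x4)) / ((x1 - x4) * (x2 - x3))"
  then show "r = (bracket d1 d3 * bracket d2 d4) / (bracket d1 d4 * bracket d2 d3)"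
    using cross_ratio_of_parameters[OF _ _ _ _ _ _ nz] by blast
qed

text \<open>The left and right flecnodal curves are the cases \<open>- \<omega>\<close> and
  \<open>\<omega>\<close>; only the sign of \<open>s * f11\<close> matters below.\<close>

definition flecnodal_curve_of_sign :: "real \<Rightarrow> (real^3) set \<Rightarrow> (real^3) set" where
  "flecnodal_curve_of_sign s S = {p. hyperbolic_point S p \<and>
     (\<exists>L. asymptotic_line_of_sign s S p L \<and> contact_more_than 3 S p L)}"

section \<open>Tangent lines of the flecnodal curves at the origin\<close>

locale generic_monge_chart = monge_chart +
  assumes exact: "\<And>L. asymptotic_line S 0 L \<Longrightarrow> contact_exactly 4 S 0 L"
begin

text \<open>Along the axes this yields vanishing pure third derivatives and nonzero pure fourth
  derivatives; the latter are factors of the denominators of the slopes.\<close>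

lemma contact_axis:
  assumes "asymptotic_line S 0 (line_through 0 v)" "v \<noteq> 0"
  shows "cubic (0, 0) (v $ 1) (v $ 2) = 0" "(ddir (xy v) ^^ 4) F (0, 0) \<noteq> 0"
proof -
  have c: "contact_more_than 3 S 0 (line_through 0 v)" "\<not> contact_more_than 4 S 0 (line_through 0 v)"
    using exact[OF assms(1)] by (auto simp: contact_exactly_def)
  show "cubic (0, 0) (v $ 1) (v $ 2) = 0"
    using c(1) contact_3_iff[OF origin_S origin_W assms(2)] by simp
  have "Suc (Suc 2) = 4" "Suc 2 = 3" by simp_all
  then show "(ddir (xy v) ^^ 4) F (0, 0) \<noteq> 0"
    using c contact_Suc_iff[OF origin_S origin_W assms(2), of 2] by (metis xy_0)
qed

lemma f30: "D1 (D1 (D1 F)) (0, 0) = 0" and f03: "D2 (D2 (D2 F)) (0, 0) = 0"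
  using contact_axis(1)[OF axes_asymptotic(1)] contact_axis(1)[OF axes_asymptotic(2)]
  by (simp_all add: axis_simps cubic_def)

lemma f40: "D1 (D1 (D1 (D1 F))) (0, 0) \<noteq> 0" and f04: "D2 (D2 (D2 (D2 F))) (0, 0) \<noteq> 0"
  using contact_axis(2)[OF axes_asymptotic(1)] contact_axis(2)[OF axes_asymptotic(2)]
  by (simp_all add: axis_simps xy_def numeral_eq_Suc)

lemma line_of_sign_0:
  assumes "asymptotic_line_of_sign s S 0 L"
  shows "s * f11 > 0 \<Longrightarrow> L = line_through 0 (axis 1 1)" "s * f11 < 0 \<Longrightarrow> L = line_through 0 (axis 2 1)"
proof -
  obtain v where v: "v \<noteq> 0" "L = line_through 0 v" "asymptotic_line S 0 L"
    "s * f11 > 0 \<Longrightarrow> \<bar>v $ 2\<bar> < \<bar>v $ 1\<bar>" "s * f11 < 0 \<Longrightarrow> \<bar>v $ 1\<bar> < \<bar>v $ 2\<bar>"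
    using line_of_sign_direction[OF origin_S origin_near assms] by blast
  have "L = line_through 0 (axis 1 1) \<or> L = line_through 0 (axis 2 1)" using v(3) axes by blast
  then have "(L = line_through 0 (axis 1 1) \<and> v $ 2 = 0) \<or> (L = line_through 0 (axis 2 1) \<and> v $ 1 = 0)"
  proof
    assume L: "L = line_through 0 (axis 1 1)"
    from line_through_eqD[OF v(2)[symmetric, unfolded L] v(1)]
    obtain c where "v = c *\<^sub>R axis 1 1" .
    then show ?thesis using L by (simp add: axis_simps)
  next
    assume L: "L = line_through 0 (axis 2 1)"
    from line_through_eqD[OF v(2)[symmetric, unfolded L] v(1)]
    obtain c where "v = c *\<^sub>R axis 2 1" .
    then show ?thesis using L by (simp add: axis_simps)
  qed
  then show "s * f11 > 0 \<Longrightarrow> L = line_through 0 (axis 1 1)" "s * f11 < 0 \<Longrightarrow> L = line_through 0 (axis 2 1)"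
    using v(4,5) by auto
qed

text \<open>Dividing \<open>quad\<close> and \<open>cubic\<close> by powers of the larger component
  of the direction leaves equations for a ratio bounded by 1, in the form required by
  \<open>tangent_equation\<close>. In the second family the ratio is that of the first component to
  the second.\<close>

lemma flecnodal_slope:
  assumes q: "q \<in> flecnodal_curve_of_sign s S" "q \<in> near"
  defines "p \<equiv> xy q"
  shows "s * f11 > 0 \<Longrightarrow> \<exists>m. \<bar>m\<bar> \<le> 1 \<and> D1 (D1 F) p + 2 * m * D1 (D2 F) p + m\<^sup>2 * D2 (D2 F) p = 0 \<and>
      D1 (D1 (D1 F)) p + 3 * m * D1 (D1 (D2 F)) p + 3 * m\<^sup>2 * D1 (D2 (D2 F)) p + m ^ 3 * D2 (D2 (D2 F)) p = 0"
    and "s * f11 < 0 \<Longrightarrow> \<exists>m. \<bar>m\<bar> \<le> 1 \<and> D2 (D2 F) p + 2 * m * D1 (D2 F) p + m\<^sup>2 * D1 (D1 F) p = 0 \<and>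
      D2 (D2 (D2 F)) p + 3 * m * D1 (D2 (D2 F)) p + 3 * m\<^sup>2 * D1 (D1 (D2 F)) p + m ^ 3 * D1 (D1 (D1 F)) p = 0"
proof -
  have qS: "q \<in> S" using q(1) by (simp add: flecnodal_curve_of_sign_def hyperbolic_point_def)
  obtain L where L: "asymptotic_line_of_sign s S q L" "contact_more_than 3 S q L"
    using q(1) by (auto simp: flecnodal_curve_of_sign_def)
  obtain v where v: "v \<noteq> 0" "L = line_through q v"
    "s * f11 > 0 \<Longrightarrow> \<bar>v $ 2\<bar> < \<bar>v $ 1\<bar>" "s * f11 < 0 \<Longrightarrow> \<bar>v $ 1\<bar> < \<bar>v $ 2\<bar>"
    using line_of_sign_direction[OF qS q(2) L(1)] by blast
  have z: "quad p (v $ 1) (v $ 2) = 0" "cubic p (v $ 1) (v $ 2) = 0"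
    using L(2) v(2) contact_3_iff[OF qS nearD(1)[OF q(2)] v(1)] asymptotic_line_iff[OF qS nearD(1)[OF q(2)] v(1)]
    by (auto simp: p_def)
  have scale: "\<exists>m. \<bar>m\<bar> \<le> 1 \<and> A + 2 * m * B + m\<^sup>2 * C = 0 \<and> P + 3 * m * Q + 3 * m\<^sup>2 * R + m ^ 3 * T = 0"
    if "\<bar>b\<bar> < \<bar>a\<bar>" "a\<^sup>2 * A + 2 * a * b * B + b\<^sup>2 * C = 0"
      "a ^ 3 * P + 3 * a\<^sup>2 * b * Q + 3 * a * b\<^sup>2 * R + b ^ 3 * T = 0" for a b A B C P Q R T :: real
  proof (intro exI conjI)
    have a: "a \<noteq> 0" using that(1) by auto
    then show "\<bar>b / a\<bar> \<le> 1" using that(1) by simp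
    have "a\<^sup>2 * (A + 2 * (b / a) * B + (b / a)\<^sup>2 * C) = 0"
      using that(2) a by (simp add: field_simps power2_eq_square)
    then show "A + 2 * (b / a) * B + (b / a)\<^sup>2 * C = 0" using a by simp
    have "a ^ 3 * (P + 3 * (b / a) * Q + 3 * (b / a)\<^sup>2 * R + (b / a) ^ 3 * T) = 0"
      using that(3) a by (simp add: field_simps power2_eq_square power3_eq_cube)
    then show "P + 3 * (b / a) * Q + 3 * (b / a)\<^sup>2 * R + (b / a) ^ 3 * T = 0" using a by simp
  qed
  show "s * f11 > 0 \<Longrightarrow> \<exists>m. \<bar>m\<bar> \<le> 1 \<and> D1 (D1 F) p + 2 * m * D1 (D2 F) p + m\<^sup>2 * D2 (D2 F) p = 0 \<and>
      D1 (D1 (D1 F)) p + 3 * m * D1 (D1 (D2 F)) p + 3 * m\<^sup>2 * D1 (D2 (D2 F)) p + m ^ 3 * D2 (D2 (D2 F)) p = 0"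
    by (rule scale[OF v(3)]) (use z in \<open>simp_all add: quad_def cubic_def\<close>)
  show "s * f11 < 0 \<Longrightarrow> \<exists>m. \<bar>m\<bar> \<le> 1 \<and> D2 (D2 F) p + 2 * m * D1 (D2 F) p + m\<^sup>2 * D1 (D1 F) p = 0 \<and>
      D2 (D2 (D2 F)) p + 3 * m * D1 (D2 (D2 F)) p + 3 * m\<^sup>2 * D1 (D1 (D2 F)) p + m ^ 3 * D1 (D1 (D1 F)) p = 0"
    by (rule scale[OF v(4)]) (use z in \<open>simp_all add: quad_def cubic_def algebra_simps\<close>)
qed

text \<open>The tangent line is \<open>x = slope1 * y\<close> for one flecnodal curve and \<open>y = slope2 * x\<close> for the other.\<close>

definition slope1 :: real where
  "slope1 = (3 * (D1 (D1 (D2 F)) (0, 0))\<^sup>2 - 2 * f11 * D1 (D1 (D1 (D2 F))) (0, 0)) /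
     (2 * f11 * D1 (D1 (D1 (D1 F))) (0, 0))"

definition slope2 :: real where
  "slope2 = (3 * (D1 (D2 (D2 F)) (0, 0))\<^sup>2 - 2 * f11 * D1 (D2 (D2 (D2 F))) (0, 0)) /
     (2 * f11 * D2 (D2 (D2 (D2 F))) (0, 0))"

text \<open>\<open>tangent_equation\<close> is applied along an arbitrary regular parametrisation,
  with the pure second and third derivatives of \<open>F\<close> as \<open>A\<close> and
  \<open>P\<close>. The outcome does not depend on the parametrisation, so it also gives the
  uniqueness needed for \<open>tangent_line\<close>.\<close>

lemma tangent_of_flecnodal_curve:
  assumes T: "smooth_curve_at (flecnodal_curve_of_sign s S) 0 T"
  shows "s * f11 > 0 \<Longrightarrow> T = line_through 0 (vector [slope1, 1, 0])"
    and "s * f11 < 0 \<Longrightarrow> T = line_through 0 (vector [1, slope2, 0])"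
proof -
  obtain N e c d where N: "open N" "0 \<in> N" and e: "e > 0" and sm: "smooth_on {-e<..<e} c"
    and reg: "\<And>t. t \<in> {-e<..<e} \<Longrightarrow> vector_derivative c (at t) \<noteq> 0"
    and hom: "homeomorphism {-e<..<e} (flecnodal_curve_of_sign s S \<inter> N) c d" and c0: "c 0 = 0"
    and T: "T = line_through 0 (vector_derivative c (at 0))"
    using T unfolding smooth_curve_at_def by blast
  define v where "v = vector_derivative c (at 0)"
  have v: "v \<noteq> 0" using reg[of 0] e by (simp add: v_def)
  have cv: "(c has_vector_derivative v) (at 0)"
    unfolding v_def by (rule smooth_on_has_vector_derivative[OF sm]) (use e in simp)
  have fl: "c t \<in> flecnodal_curve_of_sign s S" if "t \<in> {-e<..<e}" for t
    using hom that unfolding homeomorphism_def by blast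
  have "isCont c 0" using smooth_on_isCont[OF sm] e by simp
  then have "(c \<longlongrightarrow> c 0) (nhds 0)"
    by (simp add: isCont_def tendsto_at_iff_tendsto_nhds)
  then have "eventually (\<lambda>t. c t \<in> near) (nhds 0)"
    by (rule topological_tendstoD[OF _ open_near]) (simp add: c0 origin_near)
  moreover have "eventually (\<lambda>t. t \<in> {-e<..<e}) (nhds 0)"
    by (rule eventually_nhds_in_open) (use e in auto)
  ultimately have ev: "eventually (\<lambda>t. c t \<in> near \<and> c t \<in> flecnodal_curve_of_sign s S) (nhds 0)"
    by eventually_elim (use fl in blast)
  then have ev0: "eventually (\<lambda>t. c t \<in> near \<and> c t \<in> flecnodal_curve_of_sign s S) (at 0)"
    by (simp add: eventually_nhds_conv_at)
  have H: "((\<lambda>t. H (xy (c t))) has_real_derivative v $ 1 * D1 H (0, 0) + v $ 2 * D2 H (0, 0)) (at 0)"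
    if "smooth_on U H" for H
    using DERIV_along_curve[OF that cv] origin_U by (simp add: c0)
  have cont: "isCont (\<lambda>t. H (xy (c t))) 0" if "smooth_on U H" for H :: "real \<times> real \<Rightarrow> real"
    using H[OF that] by (rule DERIV_isCont)
  \<comment> \<open>The curve lies on the graph, and \<open>F\<close> has zero differential at the
    origin; so the velocity is horizontal.\<close>
  have "v $ 3 = v $ 1 * D1 F (0, 0) + v $ 2 * D2 F (0, 0)"
  proof (rule DERIV_unique)
    show "((\<lambda>t. c t $ 3) has_real_derivative v $ 3) (at 0)" by (rule has_vector_derivative_vec_nth[OF cv])
    have "eventually (\<lambda>t. c t $ 3 = F (xy (c t))) (nhds 0)"
      using ev
      by eventually_elim
        (use mem_chart nearD(1) in \<open>auto simp: flecnodal_curve_of_sign_def hyperbolic_point_def\<close>)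
    then show "((\<lambda>t. c t $ 3) has_real_derivative v $ 1 * D1 F (0, 0) + v $ 2 * D2 F (0, 0)) (at 0)"
      using H[OF smooth_F] by (subst DERIV_cong_ev[OF refl _ refl])
  qed
  then have v3: "v $ 3 = 0" by (simp add: ddir_F_0)
  have vec3: "(vector [a, b, c] :: real^3) $ 1 = a" "(vector [a, b, c] :: real^3) $ 2 = b"
    "(vector [a, b, c] :: real^3) $ 3 = c" for a b c :: real by simp_all
  note com = D_commute[OF origin_U] D_commute4[OF origin_U]
  {
    assume s: "s * f11 > 0"
    have "2 * f11 * (v $ 1 * D1 (D1 (D1 (D1 F))) (0, 0) + v $ 2 * D2 (D1 (D1 (D1 F))) (0, 0)) =
        3 * D1 (D1 (D2 F)) (xy (c 0)) * (v $ 1 * D1 (D1 (D1 F)) (0, 0) + v $ 2 * D2 (D1 (D1 F)) (0, 0))"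
    proof (rule tangent_equation[OF H _ H _ cont cont cont cont cont])
      show "eventually (\<lambda>t. \<exists>m. \<bar>m\<bar> \<le> 1 \<and>
          D1 (D1 F) (xy (c t)) + 2 * m * D1 (D2 F) (xy (c t)) + m\<^sup>2 * D2 (D2 F) (xy (c t)) = 0 \<and>
          D1 (D1 (D1 F)) (xy (c t)) + 3 * m * D1 (D1 (D2 F)) (xy (c t)) +
          3 * m\<^sup>2 * D1 (D2 (D2 F)) (xy (c t)) + m ^ 3 * D2 (D2 (D2 F)) (xy (c t)) = 0) (at 0)"
        using ev0 by eventually_elim (use flecnodal_slope(1) s in blast)
    qed (simp_all add: c0 f20 f02 f30 f11_nonzero f11_def[symmetric])
    \<comment> \<open>As \<open>f30\<close> makes the pure third derivative zero, only
      \<open>v $ 2\<close> contributes to the derivative of \<open>D1 (D1 F)\<close> along the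
      curve.\<close>
    then have "(2 * f11 * D1 (D1 (D1 (D1 F))) (0, 0)) * v $ 1 =
        (3 * (D1 (D1 (D2 F)) (0, 0))\<^sup>2 - 2 * f11 * D1 (D1 (D1 (D2 F))) (0, 0)) * v $ 2"
      by (simp add: com f30 c0 algebra_simps power2_eq_square)
    then have v1: "v $ 1 = v $ 2 * slope1"
      using f11_nonzero f40 by (simp add: slope1_def field_simps)
    then have "v $ 2 \<noteq> 0" using v v3 by (auto simp: vec_eq_iff forall_3)
    moreover have "v = (v $ 2) *\<^sub>R vector [slope1, 1, 0]"
      using v1 v3 by (simp add: vec_eq_iff forall_3)
    ultimately show "T = line_through 0 (vector [slope1, 1, 0])"
      using T line_through_scale v_def by metis
  next
    assume s: "s * f11 < 0"
    have "2 * f11 * (v $ 1 * D1 (D2 (D2 (D2 F))) (0, 0) + v $ 2 * D2 (D2 (D2 (D2 F))) (0, 0)) =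
        3 * D1 (D2 (D2 F)) (xy (c 0)) * (v $ 1 * D1 (D2 (D2 F)) (0, 0) + v $ 2 * D2 (D2 (D2 F)) (0, 0))"
    proof (rule tangent_equation[OF H _ H _ cont cont cont cont cont])
      show "eventually (\<lambda>t. \<exists>m. \<bar>m\<bar> \<le> 1 \<and>
          D2 (D2 F) (xy (c t)) + 2 * m * D1 (D2 F) (xy (c t)) + m\<^sup>2 * D1 (D1 F) (xy (c t)) = 0 \<and>
          D2 (D2 (D2 F)) (xy (c t)) + 3 * m * D1 (D2 (D2 F)) (xy (c t)) +
          3 * m\<^sup>2 * D1 (D1 (D2 F)) (xy (c t)) + m ^ 3 * D1 (D1 (D1 F)) (xy (c t)) = 0) (at 0)"
        using ev0 by eventually_elim (use flecnodal_slope(2) s in blast)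
    qed (simp_all add: c0 f20 f02 f03 f11_nonzero f11_def[symmetric])
    then have "(2 * f11 * D2 (D2 (D2 (D2 F))) (0, 0)) * v $ 2 =
        (3 * (D1 (D2 (D2 F)) (0, 0))\<^sup>2 - 2 * f11 * D1 (D2 (D2 (D2 F))) (0, 0)) * v $ 1"
      by (simp add: com f03 c0 algebra_simps power2_eq_square)
    then have v2: "v $ 2 = v $ 1 * slope2"
      using f11_nonzero f04 by (simp add: slope2_def field_simps)
    then have "v $ 1 \<noteq> 0" using v v3 by (auto simp: vec_eq_iff forall_3)
    moreover have "v = (v $ 1) *\<^sub>R vector [1, slope2, 0]"
      using v2 v3 by (simp add: vec_eq_iff forall_3)
    ultimately show "T = line_through 0 (vector [1, slope2, 0])"
      using T line_through_scale v_def by metis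
  }
qed

section \<open>Evaluation of the cr-invariant\<close>

lemma cr_invariant_eq:
  assumes \<omega>: "\<omega> \<noteq> 0" and h: "generic_hyperbonode \<omega> S 0"
  shows "cr_invariant \<omega> S 0 = 1 - slope1 * slope2"
proof -
  have fl: "left_flecnodal_curve \<omega> S = flecnodal_curve_of_sign (- \<omega>) S"
    "right_flecnodal_curve \<omega> S = flecnodal_curve_of_sign \<omega> S"
    by (simp_all add: left_flecnodal_curve_def right_flecnodal_curve_def left_asymptotic_line_def
        right_asymptotic_line_def flecnodal_curve_of_sign_def)
  have h0: "0 \<in> flecnodal_curve_of_sign (- \<omega>) S" "0 \<in> flecnodal_curve_of_sign \<omega> S"
    using h by (auto simp: generic_hyperbonode_def hyperbonode_def fl)
  obtain Tl Tr where T: "smooth_curve_at (flecnodal_curve_of_sign (- \<omega>) S) 0 Tl"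
    "smooth_curve_at (flecnodal_curve_of_sign \<omega> S) 0 Tr"
    using h by (auto simp: generic_hyperbonode_def fl)
  \<comment> \<open>Existence of a line with label \<open>s\<close> comes from the origin lying on
    the flecnodal curve of that sign, uniqueness from \<open>line_of_sign_0\<close>.\<close>
  have the_line: "(THE L. asymptotic_line_of_sign s S 0 L) = (if s * f11 > 0 then line_through 0 (axis 1 1) else line_through 0 (axis 2 1))"
    if "s \<noteq> 0" "0 \<in> flecnodal_curve_of_sign s S" for s
  proof -
    have u: "L = (if s * f11 > 0 then line_through 0 (axis 1 1) else line_through 0 (axis 2 1))"
      if "asymptotic_line_of_sign s S 0 L" for L
      using line_of_sign_0[OF that] \<open>s \<noteq> 0\<close> f11_nonzero by (cases "s * f11 > 0") (auto simp: not_less less_le)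
    have "\<exists>L. asymptotic_line_of_sign s S 0 L" using that by (auto simp: flecnodal_curve_of_sign_def)
    then show ?thesis using u by (metis the_equality)
  qed
  have tan: "tangent_line (flecnodal_curve_of_sign s S) 0 =
      (if s * f11 > 0 then line_through 0 (vector [slope1, 1, 0]) else line_through 0 (vector [1, slope2, 0]))"
    if "s \<noteq> 0" "smooth_curve_at (flecnodal_curve_of_sign s S) 0 T" for s T
  proof -
    have u: "T = (if s * f11 > 0 then line_through 0 (vector [slope1, 1, 0]) else line_through 0 (vector [1, slope2, 0]))"
      if "smooth_curve_at (flecnodal_curve_of_sign s S) 0 T" for T
      using tangent_of_flecnodal_curve[OF that] \<open>s \<noteq> 0\<close> f11_nonzero by (cases "s * f11 > 0") (auto simp: not_less less_le)
    show ?thesis unfolding tangent_line_def using u that(2) by (metis the_equality)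
  qed
  have cr: "cr_invariant \<omega> S 0 = cross_ratio 0
     (if - \<omega> * f11 > 0 then line_through 0 (vector [slope1, 1, 0]) else line_through 0 (vector [1, slope2, 0]))
     (if \<omega> * f11 > 0 then line_through 0 (axis 1 1) else line_through 0 (axis 2 1))
     (if \<omega> * f11 > 0 then line_through 0 (vector [slope1, 1, 0]) else line_through 0 (vector [1, slope2, 0]))
     (if - \<omega> * f11 > 0 then line_through 0 (axis 1 1) else line_through 0 (axis 2 1))"
    unfolding cr_invariant_def fl left_asymptotic_line_def right_asymptotic_line_def
    using the_line[OF _ h0(1)] the_line[OF _ h0(2)] tan[OF _ T(1)] tan[OF _ T(2)] \<omega> by simp
  have nz: "(vector [slope1, 1, 0] :: real^3) \<noteq> 0" "(vector [1, slope2, 0] :: real^3) \<noteq> 0"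
    by (auto simp: vec_eq_iff forall_3)
  show ?thesis
  proof (cases "\<omega> * f11 > 0")
    case True
    then have "cr_invariant \<omega> S 0 = cross_ratio 0 (line_through 0 (vector [1, slope2, 0]))
      (line_through 0 (axis 1 1)) (line_through 0 (vector [slope1, 1, 0])) (line_through 0 (axis 2 1))"
      using cr by simp
    also have "\<dots> = 1 - slope1 * slope2"
      \<comment> \<open>The bracket of the two tangent directions is
        \<open>1 - slope1 * slope2\<close>; the other three brackets are 1.\<close>
      by (subst cross_ratio_eq_bracket) (use nz in \<open>simp_all add: bracket_def axis_simps algebra_simps\<close>)
    finally show ?thesis .
  next
    case False
    then have "- \<omega> * f11 > 0" using \<omega> f11_nonzero by (auto simp: not_less less_le)
    then have "cr_invariant \<omega> S 0 = cross_ratio 0 (line_through 0 (vector [slope1, 1, 0]))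
      (line_through 0 (axis 2 1)) (line_through 0 (vector [1, slope2, 0])) (line_through 0 (axis 1 1))"
      using cr False by simp
    also have "\<dots> = 1 - slope1 * slope2"
      \<comment> \<open>Exchanging the two tangents and the two axes changes the sign of all four
        brackets, which leaves the quotient unchanged.\<close>
      by (subst cross_ratio_eq_bracket) (use nz in \<open>simp_all add: bracket_def axis_simps algebra_simps\<close>)
    finally show ?thesis .
  qed
qed

end

theorem theorem2:
  fixes S W :: "(real^3) set" and U :: "(real \<times> real) set"
    and f :: "real \<Rightarrow> real \<Rightarrow> real" and \<omega> :: real
  assumes orientation: "\<omega> = 1 \<or> \<omega> = -1"
    and surface: "smooth_surface S"
    and hyperbonode: "generic_hyperbonode \<omega> S 0"
    and U: "open U" "(0, 0) \<in> U" and f_smooth: "smooth_on U (\<lambda>(x, y). f x y)"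
    and W: "open W" "0 \<in> W"
    and graph: "S \<inter> W = {q \<in> W. (q $ 1, q $ 2) \<in> U \<and> q $ 3 = f (q $ 1) (q $ 2)}"
    and f_0: "f 0 0 = 0"
    and df_0: "((\<lambda>(x, y). f x y) has_derivative (\<lambda>_. 0)) (at (0, 0))"
    and axes: "{L. asymptotic_line S 0 L} = {line_through 0 (axis 1 1), line_through 0 (axis 2 1)}"
  shows "cr_invariant \<omega> S 0 =
    1 - ((3 * (partial0 2 1 f)\<^sup>2 - 2 * partial0 1 1 f * partial0 3 1 f) *
         (3 * (partial0 1 2 f)\<^sup>2 - 2 * partial0 1 1 f * partial0 1 3 f)) /
        (4 * (partial0 1 1 f)\<^sup>2 * partial0 4 0 f * partial0 0 4 f)"
proof -
  define F where "F = (\<lambda>(x, y). f x y)"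
  interpret generic_monge_chart S W U F
  proof
    show "\<And>L. asymptotic_line S 0 L \<Longrightarrow> contact_exactly 4 S 0 L"
      using hyperbonode by (simp add: generic_hyperbonode_def)
  qed (use assms in \<open>simp_all add: F_def\<close>)
  have "f = (\<lambda>x y. F (x, y))" by (simp add: F_def)
  then have p: "partial0 i j f = (D1 ^^ i) ((D2 ^^ j) F) (0, 0)" for i j
    using partial0_eq_ddir[OF U f_smooth[folded F_def]] by simp
  have "cr_invariant \<omega> S 0 = 1 - slope1 * slope2"
    by (rule cr_invariant_eq) (use orientation hyperbonode in auto)
  then show ?thesis
    unfolding p slope1_def slope2_def f11_def by (simp add: numeral_eq_Suc field_simps)
qed

end
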